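(* Let $n$ be even and let $p_1,\dots,p_n$ be even positive integers. Let $D$ be a diagram of a virtual link $L$ obtained by virtualizing $k$ classical crossings of the labelled standard diagram of the pretzel link $L'(p_1,p_2,\dots,p_n)$. For each $i$ let $k_i'$ (respectively $k_i$) be the number of virtualized crossings in the $i$-th strand that are labelled with odd (respectively even) integers. Then $$U(L)=\Big(\sum_{i=1}^n|k_i'-k_i|,\ \sum_{i=1}^n\frac{p_i-(k_i+k_i')-|k_i'-k_i|}{2}\Big).$$
   Context: Virtual link diagrams have classical crossings and virtual crossings; two diagrams are equivalent (represent the same virtual link) if related by a finite sequence of classical Reidemeister moves RI, RII, RIII and virtual moves VRI, VRII, VRIII and the semivirtual move SV (one classical and two virtual crossings). A diagram is trivial (represents the unlink) if it is equivalent to a diagram without crossings. Virtualizing a classical crossing means replacing it by a virtual crossing; a crossing change switches over/under information at a classical crossing. Unknotting index: for non-negative integers $m,n$, a diagram $D$ is $(m,n)$-unknottable if by virtualizing $m$ classical crossings of $D$ and applying crossing changes to $n$ classical crossings of $D$ one obtains a diagram of a trivial link. $U(D)$ is the minimum, in dictionary (lexicographic) order, of the pairs $(m,n)$ for which $D$ is $(m,n)$-unknottable, and $U(L)=\min U(D)$ over all diagrams $D$ of $L$. Pretzel links: the standard diagram of the pretzel link $L'(p_1,\dots,p_n)$, $p_i$ positive integers, consists of $n$ vertical twisted two-strand columns placed side by side, the $i$-th one having $p_i$ crossings, all columns twisted with the same handedness; neighbouring columns (and the last and first one) are joined at the top and at the bottom in the usual way, i.e. the top-right (bottom-right) end of column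 $i$ is joined to the top-left (bottom-left) end of column $i+1$, indices mod $n$. Crossings are labelled $1,2,\dots,p_1+\dots+p_n$ consecutively column by column, in order from top to bottom inside each column, so the crossings of the $i$-th column (called the $i$-th strand) carry the labels $\sum_{j=1}^{i-1}p_j+1,\dots,\sum_{j=1}^{i-1}p_j+p_i$. After virtualizing some crossings the labels are kept.
   Formalization: The case n = 2 is excluded (n is even and greater than 2): for n = 2, p_1 = p_2 = 2, virtualizing crossings 1 and 3 gives the Hopf link with U(L) = (0,1), while the formula gives (2,0). *)

theory Defs
  imports Complex_Main "HOL-Library.Product_Lexorder"
begin

text \<open>
  A link diagram in the plane is put in general position with respect to height and read
  from top to bottom as a word of elementary pieces.  The pair \<open>(x, i)\<close> is the piece \<open>x\<close> placed
  to the right of exactly \<open>i\<close> vertical strands (strands are counted from 0), all other strands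
  running straight down.  \<open>Cap\<close> is a local maximum (it creates the neighbouring strands \<open>i\<close>
  and \<open>i + 1\<close>), \<open>Cup\<close> is a local minimum (it joins strands \<open>i\<close> and \<open>i + 1\<close>).
\<close>

datatype crossing = Over | Under | Virtual
  \<comment> \<open>at \<open>Over\<close> the strand running from top left to bottom right is the upper one,
      at \<open>Under\<close> it is the lower one\<close>

datatype piece = Cap | Cup | Cross crossing

type_synonym diagram_word = "(piece \<times> nat) list"

fun strands_in :: "piece \<Rightarrow> nat" where
  "strands_in Cap = 0"
| "strands_in Cup = 2"
| "strands_in (Cross c) = 2"

fun strands_out :: "piece \<Rightarrow> nat" where
  "strands_out Cap = 2"
| "strands_out Cup = 0"
| "strands_out (Cross c) = 2"

fun strands_below :: "nat \<Rightarrow> diagram_word \<Rightarrow> nat option" where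
  "strands_below w [] = Some w"
| "strands_below w ((x, i) # D) =
     (if i + strands_in x \<le> w then strands_below (w - strands_in x + strands_out x) D else None)"

definition link_diagram :: "diagram_word \<Rightarrow> bool" where
  "link_diagram D \<longleftrightarrow> strands_below 0 D = Some 0"

fun flip :: "crossing \<Rightarrow> crossing" where
  "flip Over = Under"
| "flip Under = Over"
| "flip Virtual = Virtual"

text \<open>
  The rules \<open>far\<close>, \<open>zigzag\<close> and \<open>slide\<close> generate planar isotopy: exchanging the heights of two
  events, creating or cancelling a maximum and a minimum, and turning a crossing past an extremum.
  A crossing moved over an extremum is turned sideways, which is why \<open>flip\<close> occurs in
  \<open>slide\<close>: the upper strand stays the upper one, but its slope changes.
  All other positions of the strands in the Reidemeister moves are obtained from the ones
  listed by planar isotopy.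
\<close>

inductive local_move :: "diagram_word \<Rightarrow> diagram_word \<Rightarrow> bool" where
  far: "local_move [(x, i), (y, i + strands_out x + d)] [(y, i + strands_in x + d), (x, i)]"
| zigzag_left: "local_move [(Cap, i), (Cup, i + 1)] []"
| zigzag_right: "local_move [(Cap, i + 1), (Cup, i)] []"
| slide_cap: "local_move [(Cap, i), (Cross c, i + 1)] [(Cap, i + 1), (Cross (flip c), i)]"
| slide_cup: "local_move [(Cross c, i + 1), (Cup, i)] [(Cross (flip c), i), (Cup, i + 1)]"
| RI_cap: "c \<noteq> Virtual \<Longrightarrow> local_move [(Cap, i), (Cross c, i)] [(Cap, i)]"
| RI_cup: "c \<noteq> Virtual \<Longrightarrow> local_move [(Cross c, i), (Cup, i)] [(Cup, i)]"
| RII: "c \<noteq> Virtual \<Longrightarrow> local_move [(Cross c, i), (Cross (flip c), i)] []"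
| RIII: "c \<noteq> Virtual \<Longrightarrow>
    local_move [(Cross c, i), (Cross c, i + 1), (Cross c, i)]
               [(Cross c, i + 1), (Cross c, i), (Cross c, i + 1)]"
| VRI_cap: "local_move [(Cap, i), (Cross Virtual, i)] [(Cap, i)]"
| VRI_cup: "local_move [(Cross Virtual, i), (Cup, i)] [(Cup, i)]"
| VRII: "local_move [(Cross Virtual, i), (Cross Virtual, i)] []"
| VRIII:
    "local_move [(Cross Virtual, i), (Cross Virtual, i + 1), (Cross Virtual, i)]
                [(Cross Virtual, i + 1), (Cross Virtual, i), (Cross Virtual, i + 1)]"
| SV: "c \<noteq> Virtual \<Longrightarrow>
    local_move [(Cross c, i), (Cross Virtual, i + 1), (Cross Virtual, i)]
               [(Cross Virtual, i + 1), (Cross Virtual, i), (Cross c, i + 1)]"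

inductive diagram_move :: "diagram_word \<Rightarrow> diagram_word \<Rightarrow> bool" where
  "local_move l r \<Longrightarrow> link_diagram (u @ l @ v) \<Longrightarrow> link_diagram (u @ r @ v) \<Longrightarrow>
    diagram_move (u @ l @ v) (u @ r @ v)"

definition diagram_equiv :: "diagram_word \<Rightarrow> diagram_word \<Rightarrow> bool" where
  "diagram_equiv = equivclp diagram_move"

definition virtual_link :: "diagram_word \<Rightarrow> diagram_word set" where
  "virtual_link D = {D'. link_diagram D' \<and> diagram_equiv D D'}"

definition trivial_diagram :: "diagram_word \<Rightarrow> bool" where
  "trivial_diagram D \<longleftrightarrow> (\<exists>E. diagram_equiv D E \<and> (\<forall>c i. (Cross c, i) \<notin> set E))"

text \<open>Crossings of a diagram are referred to by their position in the word.\<close>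

definition classical_crossings :: "diagram_word \<Rightarrow> nat set" where
  "classical_crossings D = {t. t < length D \<and> (\<exists>c. c \<noteq> Virtual \<and> fst (D ! t) = Cross c)}"

definition virtualize :: "nat set \<Rightarrow> diagram_word \<Rightarrow> diagram_word" where
  "virtualize A D =
     map (\<lambda>t. if t \<in> A \<inter> classical_crossings D then (Cross Virtual, snd (D ! t)) else D ! t)
         [0..<length D]"

fun flip_piece :: "piece \<Rightarrow> piece" where
  "flip_piece (Cross c) = Cross (flip c)"
| "flip_piece Cap = Cap"
| "flip_piece Cup = Cup"

definition change_crossings :: "nat set \<Rightarrow> diagram_word \<Rightarrow> diagram_word" where
  "change_crossings B D =
     map (\<lambda>t. if t \<in> B \<inter> classical_crossings D then (flip_piece (fst (D ! t)), snd (D ! t)) else D ! t)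
         [0..<length D]"

definition unknottable :: "nat \<times> nat \<Rightarrow> diagram_word \<Rightarrow> bool" where
  "unknottable q D \<longleftrightarrow>
     (\<exists>A B. A \<subseteq> classical_crossings D \<and> card A = fst q \<and>
            B \<subseteq> classical_crossings (virtualize A D) \<and> card B = snd q \<and>
            trivial_diagram (change_crossings B (virtualize A D)))"

text \<open>The order on \<^typ>\<open>nat \<times> nat\<close> is the lexicographic one of \<^theory>\<open>HOL-Library.Product_Lexorder\<close>.\<close>

definition diagram_unknotting_index :: "diagram_word \<Rightarrow> nat \<times> nat" where
  "diagram_unknotting_index D = (LEAST q. unknottable q D)"

text \<open>
  The condition \<^term>\<open>\<exists>q. unknottable q D\<close> only keeps \<open>LEAST\<close> away from an empty set; mathematically
  it is always satisfied, since virtualizing all classical crossings yields a trivial diagram.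
\<close>

definition unknotting_index :: "diagram_word set \<Rightarrow> nat \<times> nat" where
  "unknotting_index L =
     (LEAST q. q \<in> diagram_unknotting_index ` {D \<in> L. \<exists>q. unknottable q D})"

text \<open>
  Column \<open>i\<close> (\<open>1 \<le> i \<le> n\<close>) occupies the strands \<open>2 * i - 2\<close> and \<open>2 * i - 1\<close>.  The first cap and
  the last cup join the last column to the first one, passing around all the others; the columns
  are drawn one below the other from left to right, which is planar isotopic to drawing them at
  equal height.
\<close>

definition pretzel :: "crossing \<Rightarrow> nat \<Rightarrow> (nat \<Rightarrow> nat) \<Rightarrow> diagram_word" where
  "pretzel c n p =
     [(Cap, 0)] @ map (\<lambda>i. (Cap, 2 * i - 1)) [1..<n] @
     concat (map (\<lambda>i. replicate (p i) (Cross c, 2 * i - 2)) [1..<Suc n]) @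
     map (\<lambda>i. (Cup, 2 * i - 1)) (rev [1..<n]) @ [(Cup, 0)]"

text \<open>
  The \<open>n\<close> caps precede all crossings, so the crossing labelled \<open>l \<ge> 1\<close> is at position
  \<open>n + l - 1\<close> of the word.
\<close>

definition label_position :: "nat \<Rightarrow> nat \<Rightarrow> nat" where
  "label_position n l = n + l - 1"

definition column_labels :: "(nat \<Rightarrow> nat) \<Rightarrow> nat \<Rightarrow> nat set" where
  "column_labels p i = {(\<Sum>j = 1..<i. p j) + 1 .. (\<Sum>j = 1..<i. p j) + p i}"

end

theory Submission
  imports Defs "HOL-Library.Function_Algebras"
begin

text \<open>
  The lower bound comes from the virtual linking numbers \<open>w (a, b)\<close>, the signed numbers of
  crossings in which component \<open>a\<close> passes over component \<open>b\<close>; they vanish for a trivial diagram.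
  A virtualization changes a single one of them by at most 1, and a crossing change adds the same
  number \<open>\<plusminus>1\<close> to \<open>w (a, b)\<close> and \<open>w (b, a)\<close>.  Hence for an \<open>(m, n)\<close>-unknottable
  diagram the sum of \<open>\<bar>w (a, b) - w (b, a)\<bar>\<close> over all pairs of components is at most \<open>m\<close>, and the
  sum of \<open>\<bar>w (a, b)\<bar> + \<bar>w (b, a)\<bar>\<close> is at most \<open>m + 2 n\<close>.  In the pretzel diagram each column is
  responsible for one pair of components, its odd and its even crossings having the two components
  in opposite order but equal signs.

  For the upper bound, virtualize crossings in each column until as many odd as even ones are
  classical, and change all the even ones.  Then two neighbouring classical crossings, like two
  neighbouring virtual ones, cancel by a second Reidemeister move.  If a nonempty column of even length had
  neither, its classical and virtual crossings would alternate, so that all the classical ones,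
  half of the column, would have the same parity.
\<close>

section \<open>Colourings of diagrams and their weights\<close>

type_synonym 'a strand = "'a \<times> bool"

text \<open>
  A strand carries the name of its component and its direction.  Crossings of a component with
  itself get weight 0, since otherwise the first Reidemeister move would change the total weight.
  The sign does not depend on whether \<^const>\<open>True\<close> means downwards or upwards.
\<close>

definition crossing_weight ::
  "('a \<Rightarrow> 'a \<Rightarrow> 'm::ab_group_add) \<Rightarrow> crossing \<Rightarrow> 'a strand \<Rightarrow> 'a strand \<Rightarrow> 'm" where
  "crossing_weight f c x y =
     (if c = Virtual \<or> fst x = fst y then 0
      else let g = (if c = Over then f (fst x) (fst y) else f (fst y) (fst x))
      in if (c = Over) = (snd x = snd y) then g else - g)"

text \<open>
  A colouring of a diagram is a labelling of its strands that is compatible with all pieces; its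
  existence makes \<open>s\<close> and \<open>t\<close> the labels above and below the diagram and \<open>w\<close> the total weight.
  Different components may receive the same name.
\<close>

fun colour_step ::
  "('a \<Rightarrow> 'a \<Rightarrow> 'm::ab_group_add) \<Rightarrow> piece \<Rightarrow> nat \<Rightarrow> 'a strand list \<Rightarrow> 'a strand list \<Rightarrow> 'm \<Rightarrow> bool" where
  "colour_step f x (Suc i) s t w \<longleftrightarrow> (\<exists>z s' t'. s = z # s' \<and> t = z # t' \<and> colour_step f x i s' t' w)"
| "colour_step f Cap 0 s t w \<longleftrightarrow> (\<exists>a d. t = (a, d) # (a, \<not> d) # s \<and> w = 0)"
| "colour_step f Cup 0 s t w \<longleftrightarrow> (\<exists>a d. s = (a, d) # (a, \<not> d) # t \<and> w = 0)"
| "colour_step f (Cross c) 0 s t w \<longleftrightarrow>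
     (\<exists>x y r. s = x # y # r \<and> t = y # x # r \<and> w = crossing_weight f c x y)"

fun coloured ::
  "('a \<Rightarrow> 'a \<Rightarrow> 'm::ab_group_add) \<Rightarrow> diagram_word \<Rightarrow> 'a strand list \<Rightarrow> 'a strand list \<Rightarrow> 'm \<Rightarrow> bool" where
  "coloured f [] s t w \<longleftrightarrow> s = t \<and> w = 0"
| "coloured f ((x, i) # D) s t w \<longleftrightarrow>
     (\<exists>r w1 w2. colour_step f x i s r w1 \<and> coloured f D r t w2 \<and> w = w1 + w2)"

lemma crossing_weight_Virtual [simp]: "crossing_weight f Virtual x y = 0"
  by (auto simp: crossing_weight_def)

lemma crossing_weight_same [simp]: "crossing_weight f c (a, d) (a, e) = 0"
  by (auto simp: crossing_weight_def)

lemma flip_flip [simp]: "flip (flip c) = c"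
  by (cases c) auto

lemma crossing_weight_flip [simp]:
  "crossing_weight f (flip c) y x = - crossing_weight f c x y"
  by (cases c) (auto simp: crossing_weight_def Let_def)

lemma crossing_weight_reverse:
  "crossing_weight f c x (a, \<not> d) = - crossing_weight f c x (a, d)"
  "crossing_weight f c (a, \<not> d) x = - crossing_weight f c (a, d) x"
  by (cases c; auto simp: crossing_weight_def Let_def)+

lemma coloured_append:
  "coloured f (D @ E) s t w \<longleftrightarrow>
     (\<exists>r w1 w2. coloured f D s r w1 \<and> coloured f E r t w2 \<and> w = w1 + w2)"
proof (induction D arbitrary: s w)
  case (Cons p D)
  obtain x i where p: "p = (x, i)" by fastforce
  have "coloured f (((x, i) # D) @ E) s t w \<longleftrightarrow> (\<exists>q r w1 w2 w3. colour_step f x i s q w1 \<and>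
      coloured f D q r w2 \<and> coloured f E r t w3 \<and> w = w1 + (w2 + w3))" (is "_ = ?R")
    by (simp add: Cons.IH) fast
  also have "?R \<longleftrightarrow> (\<exists>r w' w3. coloured f ((x, i) # D) s r w' \<and> coloured f E r t w3 \<and> w = w' + w3)"
    unfolding coloured.simps add.assoc[symmetric] by fast
  finally show ?case unfolding p .
qed simp

lemma colour_step_length:
  "colour_step f x i s t w \<Longrightarrow>
     i + strands_in x \<le> length s \<and> length t + strands_in x = length s + strands_out x"
  by (induction f x i s t w rule: colour_step.induct) auto

lemma coloured_strands_below:
  "coloured f D s t w \<Longrightarrow> strands_below (length s) D = Some (length t)"
proof (induction D arbitrary: s w)
  case (Cons p D)
  obtain x i where p: "p = (x, i)" by fastforce
  with Cons.prems obtain r w1 w2 where "colour_step f x i s r w1" "coloured f D r t w2" by auto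
  from colour_step_length[OF this(1)]
  have "length s - strands_in x + strands_out x = length r" "i + strands_in x \<le> length s"
    by linarith+
  with Cons.IH[OF \<open>coloured f D r t w2\<close>] show ?case by (simp add: p)
qed simp

lemma strands_below_append:
  "strands_below m (D @ E) =
     (case strands_below m D of None \<Rightarrow> None | Some k \<Rightarrow> strands_below k E)"
  by (induction m D rule: strands_below.induct) auto

section \<open>Invariance of colourings under the local moves\<close>

lemma coloured_shift1:
  "coloured f (map (\<lambda>(x, j). (x, Suc j)) D) (z # s) t w \<longleftrightarrow> (\<exists>t'. t = z # t' \<and> coloured f D s t' w)"
proof (induction D arbitrary: s t w)
  case (Cons p D)
  obtain x i where p: "p = (x, i)" by fastforce
  have "coloured f (map (\<lambda>(x, j). (x, Suc j)) (p # D)) (z # s) t w \<longleftrightarrow>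
      (\<exists>r w1 w2. colour_step f x i s r w1 \<and>
         coloured f (map (\<lambda>(x, j). (x, Suc j)) D) (z # r) t w2 \<and> w = w1 + w2)"
    unfolding p by auto
  then show ?case
    unfolding Cons.IH p coloured.simps by fast
qed auto

text \<open>Both words must fit the number of strands above: \<open>[]\<close> can be coloured with
  no strand at all, whereas a zigzag needs a strand to start from.\<close>

definition colour_invariant ::
  "('a \<Rightarrow> 'a \<Rightarrow> 'm::ab_group_add) \<Rightarrow> diagram_word \<Rightarrow> diagram_word \<Rightarrow> bool" where
  "colour_invariant f l r \<longleftrightarrow>
     (\<forall>s t w. strands_below (length s) l \<noteq> None \<longrightarrow>
        strands_below (length s) r \<noteq> None \<longrightarrow> coloured f l s t w = coloured f r s t w)"

lemma strands_below_shift1: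
  "strands_below (Suc m) (map (\<lambda>(x, j). (x, Suc j)) D) = map_option Suc (strands_below m D)"
  by (induction m D rule: strands_below.induct) (auto simp: Suc_diff_le)

lemma colour_invariant_shift1:
  assumes "colour_invariant f l r"
  shows "colour_invariant f (map (\<lambda>(x, j). (x, Suc j)) l) (map (\<lambda>(x, j). (x, Suc j)) r)"
  unfolding colour_invariant_def
proof (intro allI impI)
  fix s t :: "'a strand list" and w
  assume *: "strands_below (length s) (map (\<lambda>(x, j). (x, Suc j)) l) \<noteq> None"
    "strands_below (length s) (map (\<lambda>(x, j). (x, Suc j)) r) \<noteq> None"
  show "coloured f (map (\<lambda>(x, j). (x, Suc j)) l) s t w = coloured f (map (\<lambda>(x, j). (x, Suc j)) r) s t w"
  proof (cases s)
    case Nil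
    then have "l = []" "r = []"
      using * by (cases l; cases r; auto split: if_splits)+
    then show ?thesis by simp
  next
    case (Cons z s')
    then show ?thesis
      using * assms by (auto simp: strands_below_shift1 coloured_shift1 colour_invariant_def)
  qed
qed

text \<open>Strands to the left of a move are passed through unchanged, so each move has to be
  checked at position 0 only.\<close>

lemma colour_invariant_shift:
  "colour_invariant f l r \<Longrightarrow>
   colour_invariant f (map (\<lambda>(x, j). (x, i + j)) l) (map (\<lambda>(x, j). (x, i + j)) r)"
proof (induction i)
  case (Suc i)
  from colour_invariant_shift1[OF Suc.IH[OF Suc.prems]] show ?case
    by (simp add: comp_def case_prod_beta)
qed (simp add: case_prod_beta)

text \<open>The two pieces act on disjoint groups of strands, so both orders amount to the same
  normal form. The two weights commute because the group is abelian.\<close>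

lemma colour_invariant_far:
  "colour_invariant f [(x, 0), (y, strands_out x + d)] [(y, strands_in x + d), (x, 0)]"
  unfolding colour_invariant_def
proof (intro allI impI)
  fix s t w
  have 2: "2 + d = Suc (Suc d)" by simp
  show "coloured f [(x, 0), (y, strands_out x + d)] s t w =
    coloured f [(y, strands_in x + d), (x, 0)] s t w"
  proof (cases x)
    case Cap
    have "coloured f [(Cap, 0), (y, 2 + d)] s t w \<longleftrightarrow>
        (\<exists>a e r. t = (a, e) # (a, \<not> e) # r \<and> colour_step f y d s r w)" (is "_ = ?R")
    proof
      assume ?R
      then obtain a e r where "t = (a, e) # (a, \<not> e) # r" "colour_step f y d s r w" by blast
      then show "coloured f [(Cap, 0), (y, 2 + d)] s t w"
        unfolding 2 by simp (intro exI[of _ "(a, e) # (a, \<not> e) # s"]; simp)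
    qed (auto simp: 2)
    moreover have "coloured f [(y, d), (Cap, 0)] s t w \<longleftrightarrow>
        (\<exists>a e r. t = (a, e) # (a, \<not> e) # r \<and> colour_step f y d s r w)"
      by auto
    ultimately show ?thesis by (simp add: Cap)
  next
    case Cup
    have "coloured f [(Cup, 0), (y, d)] s t w \<longleftrightarrow>
        (\<exists>a e r. s = (a, e) # (a, \<not> e) # r \<and> colour_step f y d r t w)"
      by auto
    moreover have "coloured f [(y, 2 + d), (Cup, 0)] s t w \<longleftrightarrow>
        (\<exists>a e r. s = (a, e) # (a, \<not> e) # r \<and> colour_step f y d r t w)" (is "_ = ?R")
    proof
      assume ?R
      then obtain a e r where "s = (a, e) # (a, \<not> e) # r" "colour_step f y d r t w" by blast
      then show "coloured f [(y, 2 + d), (Cup, 0)] s t w"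
        unfolding 2 by simp (intro exI[of _ "(a, e) # (a, \<not> e) # t"]; simp)
    qed (auto simp: 2)
    ultimately show ?thesis by (simp add: Cup)
  next
    case (Cross c)
    have "coloured f [(Cross c, 0), (y, 2 + d)] s t w \<longleftrightarrow>
        (\<exists>z z' r r' w'. s = z # z' # r \<and> t = z' # z # r' \<and> colour_step f y d r r' w' \<and>
          w = crossing_weight f c z z' + w')"
      unfolding 2 by auto
    moreover have "coloured f [(y, 2 + d), (Cross c, 0)] s t w \<longleftrightarrow>
        (\<exists>z z' r r' w'. s = z # z' # r \<and> t = z' # z # r' \<and> colour_step f y d r r' w' \<and>
          w = crossing_weight f c z z' + w')"
      unfolding 2 by (auto simp: add.commute)
    ultimately show ?thesis by (simp add: Cross)
  qed
qed

lemma colour_invariant_zigzag_left: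
  fixes f :: "'a \<Rightarrow> 'a \<Rightarrow> 'm::ab_group_add" shows
  "colour_invariant f [(Cap, 0), (Cup, 1)] []"
  unfolding colour_invariant_def
proof (intro allI impI)
  fix s t :: "'a strand list" and w
  assume "strands_below (length s) [(Cap, 0), (Cup, 1)] \<noteq> None"
  then obtain a d s' where "s = (a, d) # s'" by (cases s) auto
  then show "coloured f [(Cap, 0), (Cup, 1)] s t w = coloured f [] s t w"
    \<comment> \<open>The middle leg of the zigzag runs against the strand, the two outer legs along
      it.\<close>
    by auto (intro exI[of _ "(a, d) # (a, \<not> d) # (a, d) # s'"]; simp)
qed

lemma colour_invariant_zigzag_right:
  fixes f :: "'a \<Rightarrow> 'a \<Rightarrow> 'm::ab_group_add" shows
  "colour_invariant f [(Cap, 1), (Cup, 0)] []"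
  unfolding colour_invariant_def
proof (intro allI impI)
  fix s t :: "'a strand list" and w
  assume "strands_below (length s) [(Cap, 1), (Cup, 0)] \<noteq> None"
  then obtain a d s' where "s = (a, d) # s'" by (cases s) auto
  then show "coloured f [(Cap, 1), (Cup, 0)] s t w = coloured f [] s t w"
    by auto
qed

text \<open>The strand crosses the other leg of the extremum, which has the opposite direction; this
  sign cancels the one coming from \<open>flip\<close>.\<close>

lemma colour_invariant_slide_cap:
  "colour_invariant f [(Cap, 0), (Cross c, 1)] [(Cap, 1), (Cross (flip c), 0)]"
  unfolding colour_invariant_def by (auto simp: crossing_weight_reverse)

lemma colour_invariant_slide_cup:
  "colour_invariant f [(Cross c, 1), (Cup, 0)] [(Cross (flip c), 0), (Cup, 1)]"
  unfolding colour_invariant_def by (auto simp: crossing_weight_reverse)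

text \<open>The two legs of a cap bear the same name, so their crossing has weight 0; swapping them
  merely reverses the direction chosen at the cap. Since \<open>c\<close> is arbitrary, this also
  covers the virtual move.\<close>

lemma colour_invariant_RI_cap:
  "colour_invariant f [(Cap, 0), (Cross c, 0)] [(Cap, 0)]"
  unfolding colour_invariant_def by auto

lemma colour_invariant_RI_cup:
  "colour_invariant f [(Cross c, 0), (Cup, 0)] [(Cup, 0)]"
  unfolding colour_invariant_def by auto

text \<open>The two weights are opposite by \<open>crossing_weight_flip\<close>. As
  \<open>flip\<close> fixes \<open>Virtual\<close>, the virtual move is included.\<close>

lemma colour_invariant_RII:
  fixes f :: "'a \<Rightarrow> 'a \<Rightarrow> 'm::ab_group_add" shows
  "colour_invariant f [(Cross c, 0), (Cross (flip c), 0)] []"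
  unfolding colour_invariant_def
proof (intro allI impI)
  fix s t :: "'a strand list" and w
  assume "strands_below (length s) [(Cross c, 0), (Cross (flip c), 0)] \<noteq> None"
  then have "2 \<le> length s" by (auto split: if_splits)
  then obtain a d b e s' where "s = (a, d) # (b, e) # s'"
    by (auto simp: numeral_2_eq_2 Suc_le_length_iff)
  then show "coloured f [(Cross c, 0), (Cross (flip c), 0)] s t w = coloured f [] s t w"
    by auto
qed
text \<open>On either side each two of the three strands cross exactly once, with the same one on
  the left, so the same three weights are added up in a different order.\<close>

lemma colour_invariant_RIII:
  "colour_invariant f [(Cross c, 0), (Cross c, 1), (Cross c, 0)]
               [(Cross c, 1), (Cross c, 0), (Cross c, 1)]"
  unfolding colour_invariant_def
proof (intro allI impI)
  fix s t w
  let ?R = "\<exists>x y z r. s = x # y # z # r \<and> t = z # y # x # r \<and>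
    w = crossing_weight f c x y + (crossing_weight f c x z + crossing_weight f c y z)"
  have "coloured f [(Cross c, 0), (Cross c, 1), (Cross c, 0)] s t w \<longleftrightarrow> ?R"
    by auto
  moreover have "coloured f [(Cross c, 1), (Cross c, 0), (Cross c, 1)] s t w \<longleftrightarrow> ?R"
    by (auto simp: add.commute add.left_commute)
  ultimately show "coloured f [(Cross c, 0), (Cross c, 1), (Cross c, 0)] s t w =
      coloured f [(Cross c, 1), (Cross c, 0), (Cross c, 1)] s t w"
    by blast
qed

lemma colour_invariant_SV:
  "colour_invariant f [(Cross c, 0), (Cross Virtual, 1), (Cross Virtual, 0)]
                [(Cross Virtual, 1), (Cross Virtual, 0), (Cross c, 1)]"
  unfolding colour_invariant_def by auto

lemma local_move_colour_invariant:
  "local_move l r \<Longrightarrow> colour_invariant f l r"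
proof (induction rule: local_move.induct)
  case (far x i y d)
  then show ?case using colour_invariant_shift[OF colour_invariant_far, of f i]
    by (simp add: ac_simps)
next case (zigzag_left i) then show ?case
    using colour_invariant_shift[OF colour_invariant_zigzag_left, of f i] by simp
next case (zigzag_right i) then show ?case
    using colour_invariant_shift[OF colour_invariant_zigzag_right, of f i] by simp
next case (slide_cap i c) then show ?case
    using colour_invariant_shift[OF colour_invariant_slide_cap, of f i] by simp
next case (slide_cup c i) then show ?case
    using colour_invariant_shift[OF colour_invariant_slide_cup, of f i] by simp
next case (RI_cap c i) then show ?case
    using colour_invariant_shift[OF colour_invariant_RI_cap, of f i] by simp
next case (RI_cup c i) then show ?case
    using colour_invariant_shift[OF colour_invariant_RI_cup, of f i] by simp
next case (RII c i) then show ?case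
    using colour_invariant_shift[OF colour_invariant_RII, of f i] by simp
next case (RIII c i) then show ?case
    using colour_invariant_shift[OF colour_invariant_RIII, of f i] by simp
next case (VRI_cap i) then show ?case
    using colour_invariant_shift[OF colour_invariant_RI_cap, of f i] by simp
next case (VRI_cup i) then show ?case
    using colour_invariant_shift[OF colour_invariant_RI_cup, of f i] by simp
next case (VRII i) then show ?case
    using colour_invariant_shift[OF colour_invariant_RII[of f Virtual], of i] by simp
next case (VRIII i) then show ?case
    using colour_invariant_shift[OF colour_invariant_RIII, of f i] by simp
next case (SV c i) then show ?case
    using colour_invariant_shift[OF colour_invariant_SV, of f i] by simp
qed

lemma coloured_diagram_move:
  assumes "diagram_move D E"
  shows "coloured f D [] [] w = coloured f E [] [] w"
  using assms
proof cases
  case (1 l r u v)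
  have "coloured f l s t w' = coloured f r s t w'"
    if "coloured f u [] s w''" for s t and w' w''
  proof -
    \<comment> \<open>The number of colours below \<open>u\<close> is its number of strands, so that
      both sides of the move fit there because both whole words are link diagrams.\<close>
    have "strands_below 0 u = Some (length s)"
      using coloured_strands_below[OF that] by simp
    then have "strands_below (length s) l \<noteq> None" "strands_below (length s) r \<noteq> None"
      using 1 by (auto simp: link_diagram_def strands_below_append split: option.splits)
    then show ?thesis
      using local_move_colour_invariant[OF 1(3), of f] unfolding colour_invariant_def by blast
  qed
  then show ?thesis
    unfolding 1 by (simp add: coloured_append) blast
qed

lemma coloured_diagram_equiv:
  assumes "diagram_equiv D E"
  shows "coloured f D [] [] w \<longleftrightarrow> coloured f E [] [] w"
  using assms unfolding diagram_equiv_def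
  by (induction rule: equivclp_induct) (auto simp: coloured_diagram_move)

lemma coloured_no_crossing:
  assumes "coloured f D s t w" "\<forall>c i. (Cross c, i) \<notin> set D"
  shows "w = 0"
proof -
  have step: "w' = 0" if "colour_step f x i s t w'" "\<forall>c. x \<noteq> Cross c"
    for x i and s t :: "'a strand list" and w' and f :: "'a \<Rightarrow> 'a \<Rightarrow> 'm::ab_group_add"
    using that by (induction f x i s t w' rule: colour_step.induct) auto
  show ?thesis using assms
  proof (induction f D s t w rule: coloured.induct)
    case (2 f x i D s t w)
    then obtain r w1 w2 where "colour_step f x i s r w1" "coloured f D r t w2" "w = w1 + w2"
      by auto
    with 2 step[of f x i s r w1] show ?case by fastforce
  qed simp
qed

lemma coloured_trivial_diagram:
  "trivial_diagram D \<Longrightarrow> coloured f D [] [] w \<Longrightarrow> w = 0"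
  unfolding trivial_diagram_def using coloured_diagram_equiv coloured_no_crossing by blast

section \<open>Virtualizations and crossing changes\<close>

definition is_classical :: "piece \<Rightarrow> bool" where
  "is_classical x \<longleftrightarrow> (\<exists>c. c \<noteq> Virtual \<and> x = Cross c)"

text \<open>The common form of \<open>virtualize\<close> and \<open>change_crossings\<close>, which
  lets both be handled by the same lemmas.\<close>

definition edit_at :: "(piece \<Rightarrow> piece) \<Rightarrow> nat set \<Rightarrow> diagram_word \<Rightarrow> diagram_word" where
  "edit_at g A D =
     map (\<lambda>t. if t \<in> A \<inter> classical_crossings D then (g (fst (D ! t)), snd (D ! t)) else D ! t)
       [0..<length D]"

lemma virtualize_eq_edit_at: "virtualize = edit_at (\<lambda>_. Cross Virtual)"
  by (intro ext) (simp add: virtualize_def edit_at_def)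

lemma change_crossings_eq_edit_at: "change_crossings = edit_at flip_piece"
  by (intro ext) (simp add: change_crossings_def edit_at_def)

lemma classical_crossings_Cons:
  "classical_crossings (q # D) =
     (if is_classical (fst q) then {0} else {}) \<union> Suc ` classical_crossings D"
proof (rule set_eqI)
  fix t
  show "t \<in> classical_crossings (q # D) \<longleftrightarrow>
     t \<in> (if is_classical (fst q) then {0} else {}) \<union> Suc ` classical_crossings D"
    by (cases t) (auto simp: classical_crossings_def is_classical_def)
qed

lemma finite_classical_crossings [simp]: "finite (classical_crossings D)"
  by (auto simp: classical_crossings_def)

lemma edit_at_Nil [simp]: "edit_at g A [] = []"
  by (simp add: edit_at_def)

lemma edit_at_Cons:
  "edit_at g A (q # D) =
     (if 0 \<in> A \<and> is_classical (fst q) then (g (fst q), snd q) else q) # edit_at g {t. Suc t \<in> A} D"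
proof -
  have "[0..<length (q # D)] = 0 # map Suc [0..<length D]"
    by (simp add: map_Suc_upt upt_conv_Cons del: upt_Suc)
  then show ?thesis
    by (auto simp: edit_at_def classical_crossings_Cons simp del: upt_Suc)
qed

lemma edit_at_append:
  "edit_at g A (D @ E) = edit_at g A D @ edit_at g {t. t + length D \<in> A} E"
  by (induction D arbitrary: A) (simp_all add: edit_at_Cons)

lemma edit_at_no_crossing:
  "\<forall>q \<in> set D. \<not> is_classical (fst q) \<Longrightarrow> edit_at g A D = D"
  by (induction D arbitrary: A) (simp_all add: edit_at_Cons)

text \<open>A description of exactly \<open>m\<close> edits without position sets: it is suited to
  induction along the word and adds up under concatenation.\<close>

inductive edits :: "(piece \<Rightarrow> piece) \<Rightarrow> nat \<Rightarrow> diagram_word \<Rightarrow> diagram_word \<Rightarrow> bool" for g where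
  Nil: "edits g 0 [] []"
| keep: "edits g m D E \<Longrightarrow> edits g m (q # D) (q # E)"
| edit: "edits g m D E \<Longrightarrow> is_classical x \<Longrightarrow> edits g (Suc m) ((x, i) # D) ((g x, i) # E)"

lemma Suc_vimage_image: "{t. Suc t \<in> Suc ` A} = A"
  by auto

lemma edits_imp_edit_at:
  "edits g m D E \<Longrightarrow> \<exists>A \<subseteq> classical_crossings D. card A = m \<and> E = edit_at g A D"
proof (induction rule: edits.induct)
  case Nil
  then show ?case by (intro exI[of _ "{}"]) simp
next
  case (keep m D E q)
  then obtain A where "A \<subseteq> classical_crossings D" "card A = m" "E = edit_at g A D" by auto
  then show ?case
    by (intro exI[of _ "Suc ` A"]) (auto simp: edit_at_Cons classical_crossings_Cons card_image Suc_vimage_image)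
next
  case (edit m D E x i)
  then obtain A where "A \<subseteq> classical_crossings D" "card A = m" "E = edit_at g A D" by auto
  moreover from this have "finite A" using finite_subset finite_classical_crossings by blast
  ultimately show ?case using \<open>is_classical x\<close>
    by (intro exI[of _ "insert 0 (Suc ` A)"])
      (auto simp: edit_at_Cons classical_crossings_Cons card_image Suc_vimage_image)
qed

lemma edits_edit_at:
  "A \<subseteq> classical_crossings D \<Longrightarrow> edits g (card A) D (edit_at g A D)"
proof (induction D arbitrary: A)
  case Nil
  then have "A = {}" by (simp add: classical_crossings_def)
  then show ?case by (simp add: edits.Nil)
next
  case (Cons q D)
  let ?A = "{t. Suc t \<in> A}"
  have sub: "?A \<subseteq> classical_crossings D"
    using Cons.prems by (auto simp: classical_crossings_Cons split: if_splits)
  then have fin: "finite ?A" by (rule finite_subset) simp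
  show ?case
  proof (cases "0 \<in> A")
    case True
    have "t \<in> A \<longleftrightarrow> t \<in> insert 0 (Suc ` ?A)" for t
      using True by (cases t) auto
    then have "card A = card (insert 0 (Suc ` ?A))" by (metis subsetI subset_antisym)
    then have "card A = Suc (card ?A)"
      using fin by (simp add: card_image)
    moreover have "is_classical (fst q)"
      using Cons.prems True by (auto simp: classical_crossings_Cons split: if_splits)
    ultimately show ?thesis
      using edits.edit[OF Cons.IH[OF sub], of "fst q" "snd q"] True by (simp add: edit_at_Cons)
  next
    case False
    have "t \<in> A \<longleftrightarrow> t \<in> Suc ` ?A" for t
      using False by (cases t) auto
    then have "card A = card (Suc ` ?A)" by (metis subsetI subset_antisym)
    then have "card A = card ?A" by (simp add: card_image)
    then show ?thesis
      using edits.keep[OF Cons.IH[OF sub], of q] False by (simp add: edit_at_Cons)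
  qed
qed

lemma unknottable_iff_edits:
  "unknottable q D \<longleftrightarrow>
     (\<exists>E F. edits (\<lambda>_. Cross Virtual) (fst q) D E \<and> edits flip_piece (snd q) E F \<and> trivial_diagram F)"
proof
  assume "unknottable q D"
  then obtain A B where "A \<subseteq> classical_crossings D" "card A = fst q"
    "B \<subseteq> classical_crossings (virtualize A D)" "card B = snd q"
    "trivial_diagram (change_crossings B (virtualize A D))"
    unfolding unknottable_def by blast
  then show "\<exists>E F. edits (\<lambda>_. Cross Virtual) (fst q) D E \<and> edits flip_piece (snd q) E F \<and> trivial_diagram F"
    using edits_edit_at[of A D "\<lambda>_. Cross Virtual"] edits_edit_at[of B "virtualize A D" flip_piece]
    unfolding virtualize_eq_edit_at change_crossings_eq_edit_at by metis
next
  assume "\<exists>E F. edits (\<lambda>_. Cross Virtual) (fst q) D E \<and> edits flip_piece (snd q) E F \<and> trivial_diagram F"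
  then show "unknottable q D"
    unfolding unknottable_def virtualize_eq_edit_at change_crossings_eq_edit_at
    using edits_imp_edit_at by metis
qed

lemma edits_append:
  "edits g m D E \<Longrightarrow> edits g m' D' E' \<Longrightarrow> edits g (m + m') (D @ D') (E @ E')"
  by (induction rule: edits.induct) (auto intro: edits.intros)

lemma edits_refl: "edits g 0 D D"
  by (induction D) (auto intro: edits.intros)

lemma edits_concat:
  "(\<And>i. i \<in> set is \<Longrightarrow> edits g (m i) (X i) (Y i)) \<Longrightarrow>
   edits g (sum_list (map m is)) (concat (map X is)) (concat (map Y is))"
  by (induction "is") (auto intro: edits.intros edits_append)

text \<open>Whether the strands around a crossing are coloured correctly does not depend on its
  type. A colouring therefore survives any change of type, and only the weight is affected.\<close>

lemma colour_step_crossing: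
  assumes "colour_step f (Cross c) i s t w"
  obtains x y where "w = crossing_weight f c x y"
    "\<And>c'. colour_step f (Cross c') i s t (crossing_weight f c' x y)"
proof -
  have "\<exists>x y. w = crossing_weight f c x y \<and>
      (\<forall>c'. colour_step f (Cross c') i s t (crossing_weight f c' x y))"
    using assms
  proof (induction i arbitrary: s t)
    case 0
    then obtain x y r where "s = x # y # r" "t = y # x # r" "w = crossing_weight f c x y" by auto
    then show ?case by (intro exI[of _ x] exI[of _ y]) auto
  next
    case (Suc i)
    then obtain z s' t' where *: "s = z # s'" "t = z # t'" "colour_step f (Cross c) i s' t' w" by auto
    from Suc.IH[OF *(3)] show ?case by (auto simp: *)
  qed
  then show ?thesis using that by blast
qed

text \<open>An edit leaves the colouring in place and replaces a single summand of the total weight,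
  at a cost of at most \<open>k\<close>; subadditivity adds up the costs.\<close>

lemma edits_seminorm:
  fixes f :: "'a \<Rightarrow> 'a \<Rightarrow> 'm::ab_group_add" and N :: "'m \<Rightarrow> int"
  assumes tri: "\<And>v w. N (v + w) \<le> N v + N w" and N0: "N 0 = 0"
    and step: "\<And>c x y. c \<noteq> Virtual \<Longrightarrow>
      \<exists>c'. g (Cross c) = Cross c' \<and> N (crossing_weight f c x y - crossing_weight f c' x y) \<le> k"
  shows "edits g m D E \<Longrightarrow> coloured f D s t w \<Longrightarrow>
    \<exists>w'. coloured f E s t w' \<and> N (w - w') \<le> int m * k"
proof (induction arbitrary: s w rule: edits.induct)
  case Nil
  then show ?case by (simp add: N0)
next
  case (keep m D E q)
  obtain x i where q: "q = (x, i)" by fastforce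
  with keep.prems obtain r w1 w2 where
    *: "colour_step f x i s r w1" "coloured f D r t w2" "w = w1 + w2" by auto
  from keep.IH[OF *(2)] obtain w' where "coloured f E r t w'" "N (w2 - w') \<le> int m * k" by auto
  with * show ?case by (intro exI[of _ "w1 + w'"]) (auto simp: q)
next
  case (edit m D E x i)
  obtain c where c: "x = Cross c" "c \<noteq> Virtual" using edit.hyps by (auto simp: is_classical_def)
  with edit.prems obtain r w1 w2 where
    *: "colour_step f (Cross c) i s r w1" "coloured f D r t w2" "w = w1 + w2" by auto
  obtain y z where yz: "w1 = crossing_weight f c y z"
    "\<And>c'. colour_step f (Cross c') i s r (crossing_weight f c' y z)"
    using colour_step_crossing[OF *(1)] by blast
  obtain c' where c': "g (Cross c) = Cross c'"
    "N (crossing_weight f c y z - crossing_weight f c' y z) \<le> k"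
    using step[OF c(2)] by blast
  from edit.IH[OF *(2)] obtain w' where w': "coloured f E r t w'" "N (w2 - w') \<le> int m * k" by auto
  have "w - (crossing_weight f c' y z + w') =
      (crossing_weight f c y z - crossing_weight f c' y z) + (w2 - w')"
    by (simp add: * yz)
  then have "N (w - (crossing_weight f c' y z + w')) \<le> int (Suc m) * k"
    using tri[of "crossing_weight f c y z - crossing_weight f c' y z" "w2 - w'"] c' w'
    by (simp add: algebra_simps)
  moreover have "coloured f ((g x, i) # E) s t (crossing_weight f c' y z + w')"
    using c c' w' yz by auto
  ultimately show ?case by blast
qed

section \<open>Linking norms and the lower bound\<close>

definition pair_weight :: "'a \<Rightarrow> 'a \<Rightarrow> 'a \<times> 'a \<Rightarrow> int" where
  "pair_weight a b e = of_bool (e = (a, b))"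

lemma pair_weight_swap: "pair_weight a b (x, y) = pair_weight b a (y, x)"
  by (auto simp: pair_weight_def)

text \<open>
  With \<^term>\<open>pair_weight\<close>, the value at \<open>(a, b)\<close> of the total weight is the virtual linking number
  of \<open>a\<close> over \<open>b\<close>.  A crossing change adds the same number to the values at \<open>(a, b)\<close> and at
  \<open>(b, a)\<close>, which is why it does not affect \<open>span_norm\<close>.
\<close>

definition span_norm :: "('a \<times> 'a) set \<Rightarrow> ('a \<times> 'a \<Rightarrow> int) \<Rightarrow> int" where
  "span_norm P w = (\<Sum>(a, b) \<in> P. \<bar>w (a, b) - w (b, a)\<bar>)"

definition linking_norm :: "('a \<times> 'a) set \<Rightarrow> ('a \<times> 'a \<Rightarrow> int) \<Rightarrow> int" where
  "linking_norm P w = (\<Sum>(a, b) \<in> P. \<bar>w (a, b)\<bar> + \<bar>w (b, a)\<bar>)"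

lemma span_norm_add: "span_norm P (v + w) \<le> span_norm P v + span_norm P w"
  unfolding span_norm_def sum.distrib[symmetric] by (intro sum_mono) auto

lemma linking_norm_add: "linking_norm P (v + w) \<le> linking_norm P v + linking_norm P w"
  unfolding linking_norm_def sum.distrib[symmetric] by (intro sum_mono) auto

lemma span_norm_0 [simp]: "span_norm P 0 = 0"
  by (simp add: span_norm_def)

lemma linking_norm_0 [simp]: "linking_norm P 0 = 0"
  by (simp add: linking_norm_def)

lemma span_norm_le_linking_norm: "span_norm P w \<le> linking_norm P w"
  unfolding span_norm_def linking_norm_def by (intro sum_mono) auto

lemma linking_norm_uminus: "linking_norm P (- w) = linking_norm P w"
  by (simp add: linking_norm_def)

lemma span_norm_uminus: "span_norm P (- w) = span_norm P w"
  unfolding span_norm_def by (intro sum.cong) auto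

lemma span_norm_symmetric: "(\<And>a b. w (a, b) = w (b, a)) \<Longrightarrow> span_norm P w = 0"
  unfolding span_norm_def by (intro sum.neutral) auto

text \<open>As \<open>P\<close> contains a pair of components in at most one order, the single
  nonzero value of \<open>pair_weight a b\<close> is counted at most once.\<close>

lemma linking_norm_pair_weight:
  assumes "finite P" "\<And>a b. (a, b) \<in> P \<Longrightarrow> (b, a) \<notin> P"
  shows "linking_norm P (pair_weight a b) \<le> 1"
proof -
  have "linking_norm P (pair_weight a b) =
      (\<Sum>e \<in> P. of_bool (e = (a, b)) + of_bool (e = (b, a)))"
    unfolding linking_norm_def pair_weight_def by (intro sum.cong) auto
  also have "\<dots> = of_bool ((a, b) \<in> P) + of_bool ((b, a) \<in> P)"
    using assms(1) by (simp add: sum.distrib of_bool_def)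
  also have "\<dots> \<le> 1" using assms(2) by auto
  finally show ?thesis .
qed

text \<open>A crossing change exchanges the upper and the lower component, hence the arguments of
  \<open>f\<close>, and reverses the sign.\<close>

lemma crossing_weight_cases:
  assumes "c \<noteq> Virtual"
  shows "(crossing_weight f c x y = 0 \<and> crossing_weight f (flip c) x y = 0) \<or>
    (\<exists>a b. crossing_weight f c x y = f a b \<and> crossing_weight f (flip c) x y = - f b a) \<or>
    (\<exists>a b. crossing_weight f c x y = - f a b \<and> crossing_weight f (flip c) x y = f b a)"
proof (cases "fst x = fst y")
  case True
  then show ?thesis by (simp add: crossing_weight_def)
next
  case False
  let ?a = "if c = Over then fst x else fst y" and ?b = "if c = Over then fst y else fst x"
  show ?thesis
  proof (cases "(c = Over) = (snd x = snd y)")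
    case True
    then have "crossing_weight f c x y = f ?a ?b \<and> crossing_weight f (flip c) x y = - f ?b ?a"
      using False assms by (cases c) (auto simp: crossing_weight_def)
    then show ?thesis by blast
  next
    case neq: False
    then have "crossing_weight f c x y = - f ?a ?b \<and> crossing_weight f (flip c) x y = f ?b ?a"
      using False assms by (cases c) (auto simp: crossing_weight_def)
    then show ?thesis by blast
  qed
qed

lemma unknottable_lower_bound:
  fixes D :: diagram_word and w :: "'a \<times> 'a \<Rightarrow> int"
  assumes P: "finite P" "\<And>a b. (a, b) \<in> P \<Longrightarrow> (b, a) \<notin> P"
    and D: "coloured pair_weight D [] [] w" and "unknottable q D"
  shows "span_norm P w \<le> int (fst q)" "linking_norm P w \<le> int (fst q) + 2 * int (snd q)"
proof -
  obtain E F where E: "edits (\<lambda>_. Cross Virtual) (fst q) D E"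
    and F: "edits flip_piece (snd q) E F" and "trivial_diagram F"
    using assms(4) unknottable_iff_edits by blast
  let ?N = "linking_norm P" and ?w = "crossing_weight (pair_weight :: 'a \<Rightarrow> 'a \<Rightarrow> _)"
  have pw: "?N (pair_weight a b) \<le> 1" for a b
    by (rule linking_norm_pair_weight[OF P])
  have virt: "?N (?w c x y - ?w Virtual x y) \<le> 1" if "c \<noteq> Virtual" for c x y
    using crossing_weight_cases[OF that, of pair_weight x y]
  proof (elim disjE exE conjE)
    fix a b
    assume *: "?w c x y = pair_weight a b"
    show ?thesis unfolding * crossing_weight_Virtual diff_zero by (rule pw)
  next
    fix a b
    assume *: "?w c x y = - pair_weight a b"
    show ?thesis unfolding * crossing_weight_Virtual diff_zero linking_norm_uminus by (rule pw)
  qed simp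
  \<comment> \<open>The difference is zero or, up to sign,
    \<open>pair_weight a b + pair_weight b a\<close>. This is symmetric, so invisible to
    \<open>span_norm\<close>, and has linking norm at most 2.\<close>
  have change: "?N (?w c x y - ?w (flip c) x y) \<le> 2 \<and> span_norm P (?w c x y - ?w (flip c) x y) = 0"
    if "c \<noteq> Virtual" for c x y
  proof -
    have sum: "?N (pair_weight a b + pair_weight b a) \<le> 2" for a b
      using linking_norm_add[of P "pair_weight a b" "pair_weight b a"] pw[of a b] pw[of b a] by linarith
    have symm: "span_norm P (pair_weight a b + pair_weight b a) = 0" for a b :: 'a
      by (rule span_norm_symmetric) (simp only: plus_fun_apply pair_weight_swap[of a b] add.commute)
    from crossing_weight_cases[OF that, of pair_weight x y] show ?thesis
    proof (elim disjE exE conjE)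
      assume *: "?w c x y = 0" "?w (flip c) x y = 0"
      show ?thesis unfolding * by simp
    next
      fix a b
      assume *: "?w c x y = pair_weight a b" "?w (flip c) x y = - pair_weight b a"
      show ?thesis unfolding * diff_minus_eq_add using sum symm by blast
    next
      fix a b
      assume *: "?w c x y = - pair_weight a b" "?w (flip c) x y = pair_weight b a"
      have "- pair_weight a b - pair_weight b a = - (pair_weight a b + pair_weight b a)"
        by (rule minus_add_distrib[symmetric, unfolded diff_conv_add_uminus[symmetric]])
      then show ?thesis
        unfolding * using sum[of a b] symm[of a b] by (simp only: linking_norm_uminus span_norm_uminus)
    qed
  qed
  have "\<exists>w'. coloured pair_weight E [] [] w' \<and> ?N (w - w') \<le> int (fst q) * 1"
  proof (rule edits_seminorm[OF linking_norm_add linking_norm_0 _ E D])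
    show "\<exists>c'. Cross Virtual = Cross c' \<and> ?N (?w c x y - ?w c' x y) \<le> 1" if "c \<noteq> Virtual" for c x y
      using virt[OF that] by (intro exI[of _ Virtual]) blast
  qed
  then obtain v where v: "coloured pair_weight E [] [] v" "?N (w - v) \<le> int (fst q)" by auto
  \<comment> \<open>After all edits the diagram is trivial, so the weight \<open>v\<close> left
    after the virtualizations must have been removed entirely by the crossing changes.\<close>
  have zero: "u = 0" if "coloured pair_weight F [] [] u" for u :: "'a \<times> 'a \<Rightarrow> int"
    using coloured_trivial_diagram[OF \<open>trivial_diagram F\<close> that] .
  have "\<exists>w'. coloured pair_weight F [] [] w' \<and> ?N (v - w') \<le> int (snd q) * 2"
  proof (rule edits_seminorm[OF linking_norm_add linking_norm_0 _ F v(1)])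
    show "\<exists>c'. flip_piece (Cross c) = Cross c' \<and> ?N (?w c x y - ?w c' x y) \<le> 2"
      if "c \<noteq> Virtual" for c x y
      using change[OF that] by (intro exI[of _ "flip c"]) simp
  qed
  then obtain u where "coloured pair_weight F [] [] u" "?N (v - u) \<le> int (snd q) * 2" by blast
  with zero[OF this(1)] have Nv: "?N v \<le> int (snd q) * 2" by (simp only: diff_zero)
  have "\<exists>w'. coloured pair_weight F [] [] w' \<and> span_norm P (v - w') \<le> int (snd q) * 0"
  proof (rule edits_seminorm[OF span_norm_add span_norm_0 _ F v(1)])
    show "\<exists>c'. flip_piece (Cross c) = Cross c' \<and> span_norm P (?w c x y - ?w c' x y) \<le> 0"
      if "c \<noteq> Virtual" for c x y
      using change[OF that] by (intro exI[of _ "flip c"]) simp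
  qed
  then obtain u where "coloured pair_weight F [] [] u" "span_norm P (v - u) \<le> int (snd q) * 0" by blast
  with zero[OF this(1)] have Sv: "span_norm P v \<le> 0" by (simp only: diff_zero mult_zero_right)
  \<comment> \<open>The part \<open>w - v\<close> is paid for by the virtualizations and
    \<open>v\<close> by the crossing changes; the triangle inequality combines the two
    bounds.\<close>
  have w: "w - v + v = w" by simp
  from span_norm_add[of P "w - v" v] linking_norm_add[of P "w - v" v]
  show "span_norm P w \<le> int (fst q)" "linking_norm P w \<le> int (fst q) + 2 * int (snd q)"
    unfolding w using span_norm_le_linking_norm[of P "w - v"] Nv Sv v(2) by linarith+
qed

section \<open>Columns of crossings that cancel\<close>

text \<open>\<open>diagram_move\<close> demands link diagrams on both sides; including
  \<open>link_diagram (u @ v)\<close> in the conclusion allows removals to be chained.\<close>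

definition vanishes :: "diagram_word \<Rightarrow> bool" where
  "vanishes X \<longleftrightarrow> (\<forall>u v. link_diagram (u @ X @ v) \<longrightarrow>
     link_diagram (u @ v) \<and> diagram_equiv (u @ X @ v) (u @ v))"

lemma diagram_equiv_refl: "diagram_equiv D D"
  by (simp add: diagram_equiv_def)

lemma diagram_equiv_trans:
  "diagram_equiv D E \<Longrightarrow> diagram_equiv E F \<Longrightarrow> diagram_equiv D F"
  unfolding diagram_equiv_def by (rule equivclp_trans)

lemma vanishes_Nil: "vanishes []"
  by (simp add: vanishes_def diagram_equiv_refl)

text \<open>First \<open>Y\<close> is removed in the context \<open>u @ X\<close> and
  \<open>Z @ v\<close>, then the word \<open>X @ Z\<close> that has closed up.\<close>

lemma vanishes_insert:
  assumes "vanishes (X @ Z)" "vanishes Y"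
  shows "vanishes (X @ Y @ Z)"
  unfolding vanishes_def
proof (intro allI impI)
  fix u v
  assume "link_diagram (u @ (X @ Y @ Z) @ v)"
  then have "link_diagram ((u @ X) @ Y @ Z @ v)" by simp
  then have "link_diagram ((u @ X) @ Z @ v)"
    "diagram_equiv ((u @ X) @ Y @ Z @ v) ((u @ X) @ Z @ v)"
    using assms(2) unfolding vanishes_def by blast+
  moreover from this(1) have "link_diagram (u @ (X @ Z) @ v)" by simp
  then have "link_diagram (u @ v)" "diagram_equiv (u @ (X @ Z) @ v) (u @ v)"
    using assms(1) unfolding vanishes_def by blast+
  ultimately show "link_diagram (u @ v) \<and> diagram_equiv (u @ (X @ Y @ Z) @ v) (u @ v)"
    by (auto intro: diagram_equiv_trans)
qed

lemma vanishes_concat: "(\<And>X. X \<in> set Xs \<Longrightarrow> vanishes X) \<Longrightarrow> vanishes (concat Xs)"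
proof (induction Xs)
  case (Cons X Xs)
  then show ?case using vanishes_insert[of "[]" "concat Xs" X] by simp
qed (simp add: vanishes_Nil)

lemma Suc_Suc_diff_2: "Suc (Suc i) \<le> n \<Longrightarrow> Suc (Suc (n - 2)) = n"
  by simp

lemma vanishes_crossing_pair: "vanishes [(Cross c, j), (Cross (flip c), j)]"
  unfolding vanishes_def
proof (intro allI impI)
  fix u v
  let ?X = "[(Cross c, j), (Cross (flip c), j)]"
  assume link: "link_diagram (u @ ?X @ v)"
  then have "link_diagram (u @ [] @ v)"
    by (auto simp: link_diagram_def strands_below_append Suc_Suc_diff_2 split: option.splits if_splits)
  \<comment> \<open>For \<open>c = Virtual\<close> the pair is the one of \<open>VRII\<close>,
    otherwise that of \<open>RII\<close>.\<close>
  moreover have "local_move ?X []"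
    using RII VRII by (cases c) force+
  ultimately have "diagram_move (u @ ?X @ v) (u @ [] @ v)"
    using link by (intro diagram_move.intros)
  then show "link_diagram (u @ v) \<and> diagram_equiv (u @ ?X @ v) (u @ v)"
    using \<open>link_diagram (u @ [] @ v)\<close> by (auto simp: diagram_equiv_def)
qed

text \<open>
  The two strands of a column take turns in coming from the top left, so the classical crossings
  in which a given strand is the upper one are those at positions of a fixed parity.  A column is
  encoded by the list telling which of its crossings are classical.
\<close>

fun alternate_count :: "bool \<Rightarrow> bool list \<Rightarrow> nat" where
  "alternate_count e [] = 0"
| "alternate_count e (b # bs) = of_bool (e \<and> b) + alternate_count (\<not> e) bs"

definition column :: "crossing \<Rightarrow> nat \<Rightarrow> bool list \<Rightarrow> diagram_word" where
  "column c j bs = map (\<lambda>b. (Cross (if b then c else Virtual), j)) bs"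

text \<open>\<open>e\<close> tells whether the classical crossings at the parity of the first
  position are the ones to be changed. Neighbouring classical crossings thus always have opposite
  types.\<close>

fun flipped_column :: "crossing \<Rightarrow> nat \<Rightarrow> bool \<Rightarrow> bool list \<Rightarrow> diagram_word" where
  "flipped_column c j e [] = []"
| "flipped_column c j e (b # bs) =
     (Cross (if b then if e then flip c else c else Virtual), j) # flipped_column c j (\<not> e) bs"

lemma alternate_count_append:
  "alternate_count e (u @ v) =
     alternate_count e u + alternate_count (if even (length u) then e else \<not> e) v"
  by (induction u arbitrary: e) auto

lemma flipped_column_append:
  "flipped_column c j e (u @ v) =
     flipped_column c j e u @ flipped_column c j (if even (length u) then e else \<not> e) v"
  by (induction u arbitrary: e) auto

lemma alternate_count_map_upt:
  "alternate_count e (map F [0..<m]) = card {t. t < m \<and> even t = e \<and> F t}"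
proof (induction m)
  case (Suc m)
  have "{t. t < Suc m \<and> even t = e \<and> F t} =
      (if even m = e \<and> F m then {m} else {}) \<union> {t. t < m \<and> even t = e \<and> F t}"
    by (auto simp: less_Suc_eq)
  then show ?case using Suc by (auto simp: alternate_count_append)
qed simp

text \<open>In an alternating list all \<open>True\<close> entries have positions of the same
  parity, so that one count is zero; the other is positive unless the list is
  \<open>[False]\<close>. Equal counts therefore rule out alternation in a nonempty list of even
  length.\<close>

lemma alternate_count_distinct_adj:
  "bs \<noteq> [] \<Longrightarrow> distinct_adj bs \<Longrightarrow>
   alternate_count (\<not> hd bs) bs = 0 \<and> (hd bs \<or> 2 \<le> length bs \<longrightarrow> 0 < alternate_count (hd bs) bs)"
proof (induction bs)
  case (Cons x bs)
  show ?case
  proof (cases bs)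
    case (Cons y cs)
    have "y = (\<not> x)" "distinct_adj bs" using Cons.prems Cons by auto
    then show ?thesis using Cons.IH Cons by (cases x) auto
  qed auto
qed simp

lemma not_distinct_adj_obtain:
  assumes "\<not> distinct_adj xs"
  obtains u x v where "xs = u @ x # x # v"
proof -
  have "\<not> distinct_adj xs \<Longrightarrow> \<exists>u x v. xs = u @ x # x # v"
  proof (induction xs rule: induct_list012)
    case (3 x y zs)
    show ?case
    proof (cases "x = y")
      case True
      then show ?thesis by (intro exI[of _ "[]"]) simp
    next
      case False
      then obtain u z v where "y # zs = u @ z # z # v" using 3 by auto
      then show ?thesis by (intro exI[of _ "x # u"]) simp
    qed
  qed auto
  then show ?thesis using assms that by blast
qed

lemma vanishes_flipped_column:
  "even (length bs) \<Longrightarrow> alternate_count True bs = alternate_count False bs \<Longrightarrow>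
   vanishes (flipped_column c j e bs)"
proof (induction "length bs" arbitrary: bs rule: less_induct)
  case less
  show ?case
  proof (cases "bs = []")
    case False
    then have "2 \<le> length bs" using less.prems(1) by (cases bs) (auto elim: oddE)
    then have "\<not> distinct_adj bs"
      using alternate_count_distinct_adj[OF False] less.prems(2) by (cases "hd bs") auto
    then obtain u x v where bs: "bs = u @ x # x # v" by (rule not_distinct_adj_obtain)
    \<comment> \<open>The two equal neighbours occupy one position of each parity. Deleting them
      lowers both counts equally and preserves the parities of the positions in
      \<open>v\<close>.\<close>
    have "vanishes (flipped_column c j e (u @ v))"
      by (rule less.hyps) (use less.prems in \<open>auto simp: bs alternate_count_append split: if_splits\<close>)
    \<comment> \<open>For two virtual crossings \<open>c'\<close> is \<open>Virtual\<close>; for two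
      classical ones it is \<open>c\<close> or \<open>flip c\<close>, according to the parity of
      their place.\<close>
    moreover have "\<exists>c'.
      flipped_column c j e bs = flipped_column c j e u @
         [(Cross c', j), (Cross (flip c'), j)] @ flipped_column c j (if even (length u) then e else \<not> e) v"
      by (cases x; cases e; cases "even (length u)")
        (auto simp: bs flipped_column_append intro: exI[of _ c] exI[of _ "flip c"] exI[of _ Virtual])
    then obtain c' where "flipped_column c j e bs = flipped_column c j e u @
         [(Cross c', j), (Cross (flip c'), j)] @ flipped_column c j (if even (length u) then e else \<not> e) v"
      by blast
    ultimately show ?thesis
      using vanishes_insert[OF _ vanishes_crossing_pair] by (simp add: flipped_column_append)
  qed (simp add: vanishes_Nil)
qed

text \<open>Going down the column, the first \<open>k\<close> classical crossings of the parity
  class \<open>e\<close> are virtualized. Passing to the tail exchanges the two classes, so the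
  induction hypothesis is used with \<open>\<not> e\<close>.\<close>

lemma edits_virtualize_column:
  assumes "c \<noteq> Virtual"
  shows "k \<le> alternate_count e bs \<Longrightarrow>
    \<exists>bs'. length bs' = length bs \<and> alternate_count e bs' = alternate_count e bs - k \<and>
      alternate_count (\<not> e) bs' = alternate_count (\<not> e) bs \<and>
      edits (\<lambda>_. Cross Virtual) k (column c j bs) (column c j bs')"
proof (induction bs arbitrary: e k)
  case Nil
  then show ?case by (auto simp: column_def intro: edits.intros)
next
  case (Cons b bs)
  show ?case
  proof (cases "e \<and> b \<and> 0 < k")
    case True
    then have "k - 1 \<le> alternate_count (\<not> e) bs" using Cons.prems by auto
    from Cons.IH[OF this] obtain bs' where bs': "length bs' = length bs"
      "alternate_count (\<not> e) bs' = alternate_count (\<not> e) bs - (k - 1)"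
      "alternate_count e bs' = alternate_count e bs"
      "edits (\<lambda>_. Cross Virtual) (k - 1) (column c j bs) (column c j bs')" by auto
    have "is_classical (Cross c)" using assms by (simp add: is_classical_def)
    with bs' edits.edit[OF bs'(4) this, of j] True show ?thesis
      by (intro exI[of _ "False # bs'"]) (auto simp: column_def)
  next
    case False
    then have "k \<le> alternate_count (\<not> e) bs" using Cons.prems by auto
    from Cons.IH[OF this] obtain bs' where bs': "length bs' = length bs"
      "alternate_count (\<not> e) bs' = alternate_count (\<not> e) bs - k"
      "alternate_count e bs' = alternate_count e bs"
      "edits (\<lambda>_. Cross Virtual) k (column c j bs) (column c j bs')" by auto
    with edits.keep[OF bs'(4), of "(Cross (if b then c else Virtual), j)"] \<open>k \<le> alternate_count (\<not> e) bs\<close>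
    show ?thesis
      by (intro exI[of _ "b # bs'"]) (auto simp: column_def)
  qed
qed

lemma edits_flip_column:
  assumes "c \<noteq> Virtual"
  shows "edits flip_piece (alternate_count e bs) (column c j bs) (flipped_column c j e bs)"
proof (induction bs arbitrary: e)
  case Nil
  then show ?case by (auto simp: column_def intro: edits.intros)
next
  case (Cons b bs)
  have "is_classical (Cross c)" using assms by (simp add: is_classical_def)
  from edits.keep[OF Cons.IH[of "\<not> e"]] edits.edit[OF Cons.IH[of "\<not> e"] this]
  show ?case by (force simp: column_def)
qed

lemma column_unknotting:
  assumes "c \<noteq> Virtual" "even (length bs)"
  defines "a \<equiv> alternate_count True bs" and "b \<equiv> alternate_count False bs"
  obtains X Y where "edits (\<lambda>_. Cross Virtual) (max a b - min a b) (column c j bs) X"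
    "edits flip_piece (min a b) X Y" "vanishes Y"
proof -
  \<comment> \<open>\<open>e\<close> selects the parity class with more classical crossings; its
    surplus over the other class is virtualized.\<close>
  define e where "e \<longleftrightarrow> b \<le> a"
  have "max a b - min a b \<le> alternate_count e bs"
    by (cases "b \<le> a") (auto simp: e_def a_def b_def)
  from edits_virtualize_column[OF assms(1) this, of j] obtain bs' where bs': "length bs' = length bs"
    "alternate_count e bs' = alternate_count e bs - (max a b - min a b)"
    "alternate_count (\<not> e) bs' = alternate_count (\<not> e) bs"
    "edits (\<lambda>_. Cross Virtual) (max a b - min a b) (column c j bs) (column c j bs')" by auto
  have "alternate_count True bs' = min a b \<and> alternate_count False bs' = min a b"
    using bs'(2,3) by (cases e) (auto simp: e_def a_def b_def)
  \<comment> \<open>Both classes now have \<open>min a b\<close> classical crossings; those at odd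
    positions, counted from 0, are changed.\<close>
  then show ?thesis
    using that[OF bs'(4)] edits_flip_column[OF assms(1), of False bs' j]
      vanishes_flipped_column[of bs' c j False] bs'(1) assms(2) by auto
qed

section \<open>Weights of columns\<close>

lemma colour_step_context:
  "colour_step f x i s t w \<Longrightarrow> colour_step f x (length u + i) (u @ s) (u @ t) w"
  by (induction u) auto

lemma coloured_ConsI:
  "colour_step f x i s r v \<Longrightarrow> coloured f D r t w \<Longrightarrow> coloured f ((x, i) # D) s t (v + w)"
  by auto

text \<open>Each crossing, virtual or not, swaps the two strands. Hence \<open>x\<close> is on the
  left at positions 0, 2, 4 and so on, and \<open>y\<close> at the others, and each parity class
  contributes a constant weight per classical crossing.\<close>

lemma coloured_column:
  fixes f :: "'a \<Rightarrow> 'a \<Rightarrow> 'b \<Rightarrow> int"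
  shows "coloured f (column c (length u) bs) (u @ x # y # v)
    (if even (length bs) then u @ x # y # v else u @ y # x # v)
    (\<lambda>e. int (alternate_count True bs) * crossing_weight f c x y e +
         int (alternate_count False bs) * crossing_weight f c y x e)"
proof (induction bs arbitrary: x y)
  case Nil
  then show ?case by (auto simp: column_def fun_eq_iff)
next
  case (Cons b bs)
  let ?c = "if b then c else Virtual"
    and ?w = "\<lambda>bs x y. \<lambda>e. int (alternate_count True bs) * crossing_weight f c x y e +
         int (alternate_count False bs) * crossing_weight f c y x e"
  have "colour_step f (Cross ?c) (length u) (u @ x # y # v) (u @ y # x # v) (crossing_weight f ?c x y)"
    using colour_step_context[of f "Cross ?c" 0 "x # y # v" "y # x # v" _ u] by simp
  moreover have w: "?w (b # bs) x y = crossing_weight f ?c x y + ?w bs y x"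
    by (rule ext, cases b) (simp_all add: algebra_simps)
  moreover have "column c (length u) (b # bs) = (Cross ?c, length u) # column c (length u) bs"
    by (simp add: column_def)
  ultimately have "coloured f (column c (length u) (b # bs)) (u @ x # y # v)
      (if even (length bs) then u @ y # x # v else u @ x # y # v) (?w (b # bs) x y)"
    unfolding w using coloured_ConsI[OF _ Cons.IH[of y x]] by simp
  then show ?case by (cases b; cases "even (length bs)") simp_all
qed

section \<open>Pretzel diagrams\<close>

definition pretzel_caps :: "nat \<Rightarrow> diagram_word" where
  "pretzel_caps n = (Cap, 0) # map (\<lambda>i. (Cap, 2 * i - 1)) [1..<n]"

definition pretzel_cups :: "nat \<Rightarrow> diagram_word" where
  "pretzel_cups n = map (\<lambda>i. (Cup, 2 * i - 1)) (rev [1..<n]) @ [(Cup, 0)]"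

text \<open>Labels start at 1 but positions in a column at 0, whence the \<open>Suc\<close>. An
  entry is \<open>True\<close> if the crossing remains classical.\<close>

definition column_bits :: "nat set \<Rightarrow> (nat \<Rightarrow> nat) \<Rightarrow> nat \<Rightarrow> bool list" where
  "column_bits K p i = map (\<lambda>t. Suc ((\<Sum>j = 1..<i. p j) + t) \<notin> K) [0..<p i]"

lemma virtualize_replicate:
  assumes "c \<noteq> Virtual"
  shows "virtualize A (replicate m (Cross c, j)) = column c j (map (\<lambda>t. t \<notin> A) [0..<m])"
proof (induction m arbitrary: A)
  case (Suc m)
  have "[0..<Suc m] = 0 # map Suc [0..<m]"
    by (simp add: map_Suc_upt upt_conv_Cons del: upt_Suc)
  then show ?case
    using Suc[of "{t. Suc t \<in> A}"] assms
    by (auto simp: virtualize_eq_edit_at edit_at_Cons column_def is_classical_def simp del: upt_Suc)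
qed (simp add: column_def virtualize_def)

lemma virtualize_columns:
  assumes "c \<noteq> Virtual"
  shows "virtualize {t. Suc t \<in> K} (concat (map (\<lambda>i. replicate (p i) (Cross c, 2 * i - 2)) [1..<Suc k])) =
    concat (map (\<lambda>i. column c (2 * i - 2) (column_bits K p i)) [1..<Suc k])"
proof (induction k)
  case (Suc k)
  have len: "length (concat (map (\<lambda>i. replicate (p i) (Cross c, 2 * i - 2)) [1..<Suc k])) =
      (\<Sum>j = 1..<Suc k. p j)"
    by (simp add: length_concat comp_def interv_sum_list_conv_sum_set_nat del: upt_Suc)
  have upt: "[1..<Suc (Suc k)] = [1..<Suc k] @ [Suc k]" by simp
  show ?case
    unfolding upt using Suc virtualize_replicate[OF assms]
    by (simp add: virtualize_eq_edit_at edit_at_append len column_bits_def add.commute del: upt_Suc sum.op_ivl_Suc One_nat_def)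
qed (simp add: virtualize_def)

lemma virtualize_pretzel:
  assumes "c \<noteq> Virtual" "0 < n" "0 \<notin> K"
  shows "virtualize (label_position n ` K) (pretzel c n p) =
    pretzel_caps n @ concat (map (\<lambda>i. column c (2 * i - 2) (column_bits K p i)) [1..<Suc n]) @ pretzel_cups n"
proof -
  have len: "length (pretzel_caps n) = n"
    using assms(2) by (simp add: pretzel_caps_def)
  \<comment> \<open>Behind the \<open>n\<close> caps, position \<open>t\<close> of the remaining
    word carries the label \<open>Suc t\<close>.\<close>
  have "t + n \<in> label_position n ` K \<longleftrightarrow> Suc t \<in> K" for t
  proof
    assume "t + n \<in> label_position n ` K"
    then obtain l where "l \<in> K" "t + n = n + l - 1" by (auto simp: label_position_def)
    moreover have "l \<noteq> 0" using \<open>l \<in> K\<close> assms(3) by metis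
    ultimately have "l = Suc t" by simp
    then show "Suc t \<in> K" using \<open>l \<in> K\<close> by simp
  next
    assume "Suc t \<in> K"
    then show "t + n \<in> label_position n ` K"
      by (intro image_eqI[of _ _ "Suc t"]) (simp_all add: label_position_def)
  qed
  then have shift: "{t. t + n \<in> label_position n ` K} = {t. Suc t \<in> K}" by blast
  have caps: "virtualize A (pretzel_caps n) = pretzel_caps n"
    and cups: "virtualize A (pretzel_cups n) = pretzel_cups n" for A
    unfolding virtualize_eq_edit_at
    by (rule edit_at_no_crossing, auto simp: pretzel_caps_def pretzel_cups_def is_classical_def)+
  have "pretzel c n p = pretzel_caps n @
      concat (map (\<lambda>i. replicate (p i) (Cross c, 2 * i - 2)) [1..<Suc n]) @ pretzel_cups n"
    by (simp add: pretzel_def pretzel_caps_def pretzel_cups_def del: upt_Suc)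
  then show ?thesis
    using virtualize_columns[OF assms(1), of K p n] caps cups
    by (simp add: virtualize_eq_edit_at edit_at_append len shift del: upt_Suc)
qed

text \<open>
  Component \<open>i\<close> runs in opposite directions through columns \<open>i\<close> and \<open>i + 1\<close>; component 0 belongs
  to the first and the last column.
\<close>

definition strands_upto :: "nat \<Rightarrow> nat strand list" where
  "strands_upto k = concat (map (\<lambda>i. [(i - 1, False), (i, True)]) [1..<Suc k])"

lemma strands_upto_Suc: "strands_upto (Suc k) = strands_upto k @ [(k, False), (Suc k, True)]"
  by (simp add: strands_upto_def)

lemma length_strands_upto: "length (strands_upto k) = 2 * k"
  by (induction k) (simp_all add: strands_upto_Suc, simp add: strands_upto_def)

lemma coloured_appendI:
  "coloured f D s r v \<Longrightarrow> coloured f E r t w \<Longrightarrow> coloured f (D @ E) s t (v + w)"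
  unfolding coloured_append by blast

lemma coloured_single: "colour_step f x i s t w \<Longrightarrow> coloured f [(x, i)] s t w"
  by simp

lemma coloured_pretzel_caps:
  "coloured f (pretzel_caps (Suc k)) [] (strands_upto k @ [(k, False), (0, True)]) 0"
proof (induction k)
  case 0
  then show ?case by (auto simp: pretzel_caps_def strands_upto_def intro: exI[of _ False])
next
  case (Suc k)
  \<comment> \<open>The new cap opens immediately to the left of the last strand, the one with
    colour \<open>(0, True)\<close>.\<close>
  have "colour_step f Cap 0 [(0, True)] [(Suc k, True), (Suc k, False), (0, True)] 0"
    by (auto intro: exI[of _ True])
  from colour_step_context[OF this, of "strands_upto k @ [(k, False)]"]
  have "colour_step f Cap (Suc (2 * k)) (strands_upto k @ [(k, False), (0, True)])
      (strands_upto (Suc k) @ [(Suc k, False), (0, True)]) 0"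
    by (simp add: strands_upto_Suc length_strands_upto del: colour_step.simps)
  from coloured_appendI[OF Suc coloured_single[OF this]] show ?case
    by (simp add: pretzel_caps_def)
qed

lemma coloured_pretzel_cups:
  "coloured f (pretzel_cups (Suc k)) (strands_upto k @ [(k, False), (0, True)]) [] 0"
proof (induction k)
  case 0
  then show ?case by (auto simp: pretzel_cups_def strands_upto_def intro: exI[of _ False])
next
  case (Suc k)
  have "colour_step f Cup 0 [(Suc k, True), (Suc k, False), (0, True)] [(0, True)] 0"
    by (auto intro: exI[of _ True])
  from colour_step_context[OF this, of "strands_upto k @ [(k, False)]"]
  have "colour_step f Cup (Suc (2 * k)) (strands_upto (Suc k) @ [(Suc k, False), (0, True)])
      (strands_upto k @ [(k, False), (0, True)]) 0"
    by (simp add: strands_upto_Suc length_strands_upto del: colour_step.simps)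
  from coloured_appendI[OF coloured_single[OF this] Suc] show ?case
    by (simp add: pretzel_cups_def)
qed

text \<open>The reduction mod \<open>n\<close> affects only the last column, whose right strand
  belongs to component 0; all columns then have a uniform description.\<close>

lemma strands_upto_cyclic:
  assumes "0 < n"
  shows "strands_upto (n - 1) @ [(n - 1, False), (0, True)] =
    concat (map (\<lambda>i. [(i - 1, False), (i mod n, True)]) [1..<Suc n])"
proof -
  obtain k where n: "n = Suc k" using assms by (cases n) auto
  have "strands_upto k = concat (map (\<lambda>i. [(i - 1, False), (i mod n, True)]) [1..<Suc k])"
    unfolding strands_upto_def by (intro arg_cong[of _ _ concat] map_cong) (auto simp: n)
  moreover have "[1..<Suc n] = [1..<Suc k] @ [n]" by (simp add: n)
  ultimately show ?thesis by (simp add: n del: upt_Suc One_nat_def)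
qed

text \<open>A column of even length restores the order of its strands, so the same colours
  \<open>st\<close> occur between any two columns and the weights just add up.\<close>

lemma coloured_columns:
  fixes f :: "'a \<Rightarrow> 'a \<Rightarrow> 'b \<Rightarrow> int" and x y :: "nat \<Rightarrow> 'a strand"
  assumes "\<And>i. i \<in> {1..n} \<Longrightarrow> even (length (bs i))" "m \<le> n"
  defines "st \<equiv> concat (map (\<lambda>i. [x i, y i]) [1..<Suc n])"
  shows "coloured f (concat (map (\<lambda>i. column c (2 * i - 2) (bs i)) [1..<Suc m])) st st
    (\<lambda>e. \<Sum>i = 1..m. int (alternate_count True (bs i)) * crossing_weight f c (x i) (y i) e +
       int (alternate_count False (bs i)) * crossing_weight f c (y i) (x i) e)"
  using assms(2)
proof (induction m)
  case 0
  then show ?case by (simp add: fun_eq_iff)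
next
  case (Suc m)
  have "[1..<Suc n] = [1..<Suc m] @ [Suc m..<Suc n]"
    using Suc.prems upt_add_eq_append[of 1 "Suc m" "n - m"] by simp
  also have "[Suc m..<Suc n] = Suc m # [Suc (Suc m)..<Suc n]"
    using Suc.prems by (simp add: upt_conv_Cons del: upt_Suc)
  finally have upt: "[1..<Suc n] = [1..<Suc m] @ Suc m # [Suc (Suc m)..<Suc n]" .
  define u where "u = concat (map (\<lambda>i. [x i, y i]) [1..<Suc m])"
  define v where "v = concat (map (\<lambda>i. [x i, y i]) [Suc (Suc m)..<Suc n])"
  have st: "st = u @ x (Suc m) # y (Suc m) # v"
    unfolding st_def upt u_def v_def by (simp del: upt_Suc)
  have "length u = 2 * Suc m - 2"
    by (simp add: u_def length_concat comp_def sum_list_triv del: upt_Suc)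
  then have "coloured f (column c (2 * Suc m - 2) (bs (Suc m))) st st
    (\<lambda>e. int (alternate_count True (bs (Suc m))) * crossing_weight f c (x (Suc m)) (y (Suc m)) e +
       int (alternate_count False (bs (Suc m))) * crossing_weight f c (y (Suc m)) (x (Suc m)) e)"
    using coloured_column[of f c u "bs (Suc m)" "x (Suc m)" "y (Suc m)" v] assms(1)[of "Suc m"] Suc.prems
    by (simp add: st)
  from coloured_appendI[OF Suc.IH this] Suc.prems show ?case
    by (simp add: plus_fun_def)
qed

section \<open>Label parities and the upper bound\<close>

lemma card_even_eq: "card {t. t < 2 * m \<and> even t = e} = m"
proof (induction m)
  case (Suc m)
  have "{t. t < 2 * Suc m \<and> even t = e} =
      insert (if e then 2 * m else Suc (2 * m)) {t. t < 2 * m \<and> even t = e}"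
    by (auto simp: less_Suc_eq)
  then show ?case using Suc by (cases e) auto
qed simp

text \<open>As an even number of labels precedes the column, odd labels are at even positions
  counted from 0. Half of the crossings belong to each class, and each of them is either classical
  or virtualized.\<close>

lemma alternate_count_column_bits:
  assumes "even (p i)" "even (\<Sum>j = 1..<i. p j)"
  shows "alternate_count e (column_bits K p i) + card {l \<in> K \<inter> column_labels p i. odd l = e} = p i div 2"
proof -
  let ?S = "\<Sum>j = 1..<i. p j"
  let ?A = "{t. t < p i \<and> even t = e \<and> Suc (?S + t) \<in> K}"
  let ?B = "{t. t < p i \<and> even t = e \<and> Suc (?S + t) \<notin> K}"
  have "{l \<in> K \<inter> column_labels p i. odd l = e} = (\<lambda>t. Suc (?S + t)) ` ?A"
  proof (intro equalityI subsetI)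
    fix l assume l: "l \<in> {l \<in> K \<inter> column_labels p i. odd l = e}"
    then obtain t where t: "l = Suc (?S + t)"
      using le_Suc_ex[of "Suc ?S" l] by (auto simp: column_labels_def)
    then have "t \<in> ?A" using l assms(2) by (auto simp: column_labels_def)
    then show "l \<in> (\<lambda>t. Suc (?S + t)) ` ?A" using t by blast
  qed (use assms(2) in \<open>auto simp: column_labels_def\<close>)
  then have "card {l \<in> K \<inter> column_labels p i. odd l = e} = card ?A"
    by (simp add: card_image inj_on_def)
  moreover have "card (?A \<union> ?B) = card ?A + card ?B"
    by (rule card_Un_disjoint) auto
  moreover have "?A \<union> ?B = {t. t < 2 * (p i div 2) \<and> even t = e}"
    using assms(1) by auto
  ultimately show ?thesis
    by (simp add: column_bits_def alternate_count_map_upt card_even_eq)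
qed

text \<open>Crossings are replaced by crossings, which have the same numbers of strands above and
  below.\<close>

lemma edits_strands_below:
  assumes "\<And>c. \<exists>c'. g (Cross c) = Cross c'"
  shows "edits g m D E \<Longrightarrow> strands_below k E = strands_below k D"
proof (induction arbitrary: k rule: edits.induct)
  case (keep m D E q)
  then show ?case by (cases q) simp
next
  case (edit m D E x i)
  obtain c where c: "x = Cross c" using edit.hyps unfolding is_classical_def by blast
  moreover obtain c' where "g (Cross c) = Cross c'" using assms by blast
  ultimately have "strands_in (g x) = strands_in x" "strands_out (g x) = strands_out x" by simp_all
  then show ?case using edit.IH by simp
qed simp

text \<open>The columns are treated independently; once all of them have vanished, only caps and
  cups are left.\<close>

lemma unknottable_pretzel:
  assumes "c \<noteq> Virtual" "\<And>i. i \<in> {1..n} \<Longrightarrow> even (length (bs i))"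
    and "link_diagram D"
    and D: "D = pretzel_caps n @ concat (map (\<lambda>i. column c (2 * i - 2) (bs i)) [1..<Suc n]) @ pretzel_cups n"
  defines "a \<equiv> \<lambda>i. alternate_count True (bs i)" and "b \<equiv> \<lambda>i. alternate_count False (bs i)"
  shows "unknottable (\<Sum>i = 1..n. max (a i) (b i) - min (a i) (b i), \<Sum>i = 1..n. min (a i) (b i)) D"
proof -
  have "\<forall>i \<in> {1..n}. \<exists>XY. edits (\<lambda>_. Cross Virtual) (max (a i) (b i) - min (a i) (b i))
        (column c (2 * i - 2) (bs i)) (fst XY) \<and>
      edits flip_piece (min (a i) (b i)) (fst XY) (snd XY) \<and> vanishes (snd XY)"
    using column_unknotting[OF assms(1,2)] unfolding a_def b_def by (metis fst_conv snd_conv)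
  then obtain XY where XY: "\<And>i. i \<in> {1..n} \<Longrightarrow>
      edits (\<lambda>_. Cross Virtual) (max (a i) (b i) - min (a i) (b i))
        (column c (2 * i - 2) (bs i)) (fst (XY i))"
    "\<And>i. i \<in> {1..n} \<Longrightarrow> edits flip_piece (min (a i) (b i)) (fst (XY i)) (snd (XY i))"
    "\<And>i. i \<in> {1..n} \<Longrightarrow> vanishes (snd (XY i))"
    by metis
  have set: "set [1..<Suc n] = {1..n}" by auto
  have sum: "sum_list (map g [1..<Suc n]) = (\<Sum>i = 1..n. g i)" for g :: "nat \<Rightarrow> nat"
    by (simp add: interv_sum_list_conv_sum_set_nat atLeastLessThanSuc_atLeastAtMost del: upt_Suc)
  define W where "W Z = pretzel_caps n @ concat (map Z [1..<Suc n]) @ pretzel_cups n"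
    for Z :: "nat \<Rightarrow> diagram_word"
  have edits_W: "edits g (\<Sum>i = 1..n. m i) (W Z) (W Z')"
    if "\<And>i. i \<in> {1..n} \<Longrightarrow> edits g (m i) (Z i) (Z' i)" for g m Z Z'
    using edits_append[OF edits_refl edits_append[OF edits_concat[of "[1..<Suc n]" g m Z Z'] edits_refl],
        of "pretzel_caps n" "pretzel_cups n"] that
    unfolding W_def set sum by simp
  have 1: "edits (\<lambda>_. Cross Virtual) (\<Sum>i = 1..n. max (a i) (b i) - min (a i) (b i)) D (W (\<lambda>i. fst (XY i)))"
    using edits_W[OF XY(1)] unfolding D W_def .
  have 2: "edits flip_piece (\<Sum>i = 1..n. min (a i) (b i)) (W (\<lambda>i. fst (XY i))) (W (\<lambda>i. snd (XY i)))"
    by (rule edits_W[OF XY(2)])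
  have "vanishes (concat (map (\<lambda>i. snd (XY i)) [1..<Suc n]))"
    by (rule vanishes_concat) (use XY(3) in \<open>auto simp del: upt_Suc\<close>)
  moreover have "link_diagram (W (\<lambda>i. snd (XY i)))"
    using edits_strands_below[OF _ 1, of 0] edits_strands_below[OF _ 2, of 0] assms(3)
    by (simp add: link_diagram_def)
  ultimately have "diagram_equiv (W (\<lambda>i. snd (XY i))) (pretzel_caps n @ pretzel_cups n)"
    unfolding vanishes_def W_def by blast
  then have "trivial_diagram (W (\<lambda>i. snd (XY i)))"
    unfolding trivial_diagram_def
    by (intro exI[of _ "pretzel_caps n @ pretzel_cups n"])
      (auto simp: pretzel_caps_def pretzel_cups_def)
  then show ?thesis
    unfolding unknottable_iff_edits using 1 2 by (metis fst_conv snd_conv)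
qed

section \<open>Linking numbers of the pretzel diagram\<close>

lemma crossing_weight_cyclic:
  fixes n i j :: nat
  assumes "2 < n" "i \<in> {1..n}" "j \<in> {1..n}" "c \<noteq> Virtual"
  shows "crossing_weight pair_weight c (i - 1, False) (i mod n, True) (j - 1, j mod n) =
      - of_bool (i = j \<and> c = Over)"
    "crossing_weight pair_weight c (i - 1, False) (i mod n, True) (j mod n, j - 1) =
      of_bool (i = j \<and> c = Under)"
    "crossing_weight pair_weight c (i mod n, True) (i - 1, False) (j - 1, j mod n) =
      of_bool (i = j \<and> c = Under)"
    "crossing_weight pair_weight c (i mod n, True) (i - 1, False) (j mod n, j - 1) =
      - of_bool (i = j \<and> c = Over)"
proof -
  \<comment> \<open>For \<open>n > 2\<close> the two components of a column are distinct, and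
    different columns have different unordered pairs of components. With two columns both would
    share the same pair.\<close>
  have "i - 1 \<noteq> i mod n" "i - 1 = j - 1 \<longleftrightarrow> i = j" "\<not> (i mod n = j - 1 \<and> i - 1 = j mod n)"
    using assms by (cases "i = n"; cases "j = n"; auto)+
  moreover have "pair_weight x y (x', y') = of_bool (x' = x \<and> y' = y)" for x y x' y' :: nat
    by (simp add: pair_weight_def)
  ultimately show "crossing_weight pair_weight c (i - 1, False) (i mod n, True) (j - 1, j mod n) =
      - of_bool (i = j \<and> c = Over)"
    "crossing_weight pair_weight c (i - 1, False) (i mod n, True) (j mod n, j - 1) =
      of_bool (i = j \<and> c = Under)"
    "crossing_weight pair_weight c (i mod n, True) (i - 1, False) (j - 1, j mod n) =
      of_bool (i = j \<and> c = Under)"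
    "crossing_weight pair_weight c (i mod n, True) (i - 1, False) (j mod n, j - 1) =
      - of_bool (i = j \<and> c = Over)"
    using assms(4) by (cases c; force simp: crossing_weight_def)+
qed

theorem theorem3p2:
  fixes n k :: nat
    and p k_odd k_even :: "nat \<Rightarrow> nat"
    and c :: crossing
    and K :: "nat set"
    and D :: diagram_word
    and L :: "diagram_word set"
  assumes "even n" and "2 < n"
    and "\<And>i. i \<in> {1..n} \<Longrightarrow> even (p i) \<and> 0 < p i"
    and "c \<noteq> Virtual"
    and "K \<subseteq> {1..(\<Sum>i = 1..n. p i)}" and "card K = k"
    and "D = virtualize (label_position n ` K) (pretzel c n p)"
    and "L = virtual_link D"
    and "\<And>i. i \<in> {1..n} \<Longrightarrow> k_odd i = card {l \<in> K \<inter> column_labels p i. odd l}"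
    and "\<And>i. i \<in> {1..n} \<Longrightarrow> k_even i = card {l \<in> K \<inter> column_labels p i. even l}"
  shows "map_prod real real (unknotting_index L) =
     (\<Sum>i = 1..n. \<bar>real (k_odd i) - real (k_even i)\<bar>,
      \<Sum>i = 1..n. (real (p i) - (real (k_even i) + real (k_odd i)) - \<bar>real (k_odd i) - real (k_even i)\<bar>) / 2)"
proof -
  define bs where "bs = column_bits K p"
  \<comment> \<open>\<open>a i\<close> and \<open>b i\<close> are the numbers of classical crossings
    of column \<open>i\<close> with odd and with even labels.\<close>
  define a where "a i = alternate_count True (bs i)" for i
  define b where "b i = alternate_count False (bs i)" for i
  \<comment> \<open>One ordered pair for the two components that meet in each column.\<close>
  define P where "P = (\<lambda>i. (i - 1, i mod n)) ` {1..n}"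
  define q where "q = (\<Sum>i = 1..n. max (a i) (b i) - min (a i) (b i), \<Sum>i = 1..n. min (a i) (b i))"
  have ab: "a i + k_odd i = p i div 2" "b i + k_even i = p i div 2" if "i \<in> {1..n}" for i
  proof -
    have "even (\<Sum>j = 1..<i. p j)" using that assms(3) by (intro dvd_sum) auto
    then show "a i + k_odd i = p i div 2" "b i + k_even i = p i div 2"
      using alternate_count_column_bits[of p i True K] alternate_count_column_bits[of p i False K]
        assms(3,9,10)[OF that] by (simp_all add: a_def b_def bs_def)
  qed
  have even_bs: "even (length (bs i))" if "i \<in> {1..n}" for i
    using assms(3)[OF that] by (simp add: bs_def column_bits_def)
  have D: "D = pretzel_caps n @ concat (map (\<lambda>i. column c (2 * i - 2) (bs i)) [1..<Suc n]) @ pretzel_cups n"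
    unfolding assms(7) bs_def using assms(2,4,5) by (intro virtualize_pretzel) auto

  define w where "w = (\<lambda>e. \<Sum>i = 1..n.
    int (a i) * crossing_weight pair_weight c (i - 1, False) (i mod n, True) e +
    int (b i) * crossing_weight pair_weight c (i mod n, True) (i - 1, False) e)"
  have "coloured pair_weight D [] [] w"
  proof -
    define st where "st = concat (map (\<lambda>i. [(i - 1, False), (i mod n, True)]) [1..<Suc n])"
    have st: "strands_upto (n - 1) @ [(n - 1, False), (0, True)] = st" "Suc (n - 1) = n"
      using strands_upto_cyclic[of n] assms(2) by (simp_all add: st_def del: upt_Suc)
    have "coloured pair_weight (pretzel_caps n) [] st 0" "coloured pair_weight (pretzel_cups n) st [] 0"
      using coloured_pretzel_caps[of pair_weight "n - 1"] coloured_pretzel_cups[of pair_weight "n - 1"]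
      unfolding st .
    moreover have "coloured pair_weight (concat (map (\<lambda>i. column c (2 * i - 2) (bs i)) [1..<Suc n])) st st w"
      unfolding w_def a_def b_def st_def by (rule coloured_columns) (use even_bs in auto)
    ultimately have "coloured pair_weight D [] [] (0 + (w + 0))"
      unfolding D by (intro coloured_appendI)
    then show ?thesis by simp
  qed
  note col = this
  \<comment> \<open>A colouring without strands at top and bottom already certifies the strand
    counts.\<close>
  have link: "link_diagram D"
    using coloured_strands_below[OF col] by (simp add: link_diagram_def)

  have w: "w (j - 1, j mod n) = (if c = Over then - int (a j) else int (b j))"
    "w (j mod n, j - 1) = (if c = Over then - int (b j) else int (a j))" if j: "j \<in> {1..n}" for j
  proof -
    \<comment> \<open>Only column \<open>j\<close> contributes to the linking numbers of its pair of
      components.\<close>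
    have "w (j - 1, j mod n) = (\<Sum>i = 1..n. if j = i then (if c = Over then - int (a j) else int (b j)) else 0)"
      (is "_ = sum ?g _")
      unfolding w_def
    proof (intro sum.cong refl)
      fix i assume i: "i \<in> {1..n}"
      show "int (a i) * crossing_weight pair_weight c (i - 1, False) (i mod n, True) (j - 1, j mod n) +
          int (b i) * crossing_weight pair_weight c (i mod n, True) (i - 1, False) (j - 1, j mod n) = ?g i"
        unfolding crossing_weight_cyclic[OF assms(2) i j assms(4)] using assms(4) by (cases c) auto
    qed
    then show "w (j - 1, j mod n) = (if c = Over then - int (a j) else int (b j))"
      using j by simp
    have "w (j mod n, j - 1) = (\<Sum>i = 1..n. if j = i then (if c = Over then - int (b j) else int (a j)) else 0)"
      (is "_ = sum ?g _")
      unfolding w_def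
    proof (intro sum.cong refl)
      fix i assume i: "i \<in> {1..n}"
      show "int (a i) * crossing_weight pair_weight c (i - 1, False) (i mod n, True) (j mod n, j - 1) +
          int (b i) * crossing_weight pair_weight c (i mod n, True) (i - 1, False) (j mod n, j - 1) = ?g i"
        unfolding crossing_weight_cyclic[OF assms(2) i j assms(4)] using assms(4) by (cases c) auto
    qed
    then show "w (j mod n, j - 1) = (if c = Over then - int (b j) else int (a j))"
      using j by simp
  qed
  have "inj_on (\<lambda>i. (i - 1, i mod n)) {1..n}"
    by (rule inj_onI) auto
  then have norms: "span_norm P w = (\<Sum>i = 1..n. \<bar>int (a i) - int (b i)\<bar>)"
    "linking_norm P w = (\<Sum>i = 1..n. int (a i) + int (b i))"
    unfolding span_norm_def linking_norm_def P_def by (auto simp: sum.reindex w simp del: One_nat_def intro!: sum.cong)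
  have P: "finite P" "\<And>x y. (x, y) \<in> P \<Longrightarrow> (y, x) \<notin> P"
  proof -
    show "finite P" by (simp add: P_def)
    have "\<not> (i mod n = j - 1 \<and> i - 1 = j mod n)" if "i \<in> {1..n}" "j \<in> {1..n}" for i j
      using that assms(2) by (cases "i = n"; cases "j = n"; auto)
    then show "(y, x) \<notin> P" if "(x, y) \<in> P" for x y
      using that unfolding P_def by auto
  qed
  have lower: "q \<le> r" if "E \<in> L" "unknottable r E" for r E
  proof -
    \<comment> \<open>Invariance transports the weight \<open>w\<close> to every diagram of
      \<open>L\<close>, so the bound holds for all of them and not only for
      \<open>D\<close>.\<close>
    have "coloured pair_weight E [] [] w"
      using that(1) col coloured_diagram_equiv unfolding assms(8) virtual_link_def by blast
    from unknottable_lower_bound[OF P this that(2)]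
    have "(\<Sum>i = 1..n. \<bar>int (a i) - int (b i)\<bar>) \<le> int (fst r)"
      "(\<Sum>i = 1..n. int (a i) + int (b i)) \<le> int (fst r) + 2 * int (snd r)"
      unfolding norms by blast+
    moreover have "(\<Sum>i = 1..n. \<bar>int (a i) - int (b i)\<bar>) = int (fst q)"
      unfolding q_def fst_conv of_nat_sum by (intro sum.cong) auto
    moreover have "(\<Sum>i = 1..n. int (a i) + int (b i)) = int (fst q) + 2 * int (snd q)"
      unfolding q_def fst_conv snd_conv of_nat_sum sum_distrib_left sum.distrib[symmetric]
      by (intro sum.cong) auto
    \<comment> \<open>In the lexicographic order the first inequality decides unless the first
      components agree; then the second one bounds \<open>snd r\<close> from below.\<close>
    ultimately show ?thesis by (auto simp: less_eq_prod_def)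
  qed
  have upper: "unknottable q D"
    unfolding q_def a_def b_def by (rule unknottable_pretzel[OF assms(4) even_bs link D])
  have "D \<in> L"
    using link by (simp add: assms(8) virtual_link_def diagram_equiv_refl)
  have "diagram_unknotting_index D = q"
    unfolding diagram_unknotting_index_def using upper lower[OF \<open>D \<in> L\<close>] by (rule Least_equality)
  have "unknotting_index L = q"
    unfolding unknotting_index_def
  proof (rule Least_equality)
    show "q \<in> diagram_unknotting_index ` {D \<in> L. \<exists>q. unknottable q D}"
      using \<open>diagram_unknotting_index D = q\<close> \<open>D \<in> L\<close> upper by blast
    fix r assume "r \<in> diagram_unknotting_index ` {D \<in> L. \<exists>q. unknottable q D}"
    then obtain E where "E \<in> L" "\<exists>q. unknottable q E" "r = diagram_unknotting_index E" by blast
    then show "q \<le> r"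
      using lower LeastI_ex[of "\<lambda>q. unknottable q E"] unfolding diagram_unknotting_index_def by blast
  qed
  have real_eq: "real (max (a i) (b i) - min (a i) (b i)) = \<bar>real (k_odd i) - real (k_even i)\<bar>"
    "real (min (a i) (b i)) =
      (real (p i) - (real (k_even i) + real (k_odd i)) - \<bar>real (k_odd i) - real (k_even i)\<bar>) / 2"
    if "i \<in> {1..n}" for i
  proof -
    \<comment> \<open>Evenness of \<open>p i\<close> makes the halving exact. As
      \<open>a i + k_odd i\<close> and \<open>b i + k_even i\<close> coincide, the differences of
      the two pairs of counts agree up to sign.\<close>
    have "p i = 2 * (p i div 2)" using assms(3)[OF that] by simp
    then have "real (p i) = 2 * real (a i) + 2 * real (k_odd i)" "real (a i) + real (k_odd i) = real (b i) + real (k_even i)"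
      using ab[OF that] by linarith+
    then show "real (max (a i) (b i) - min (a i) (b i)) = \<bar>real (k_odd i) - real (k_even i)\<bar>"
      "real (min (a i) (b i)) =
        (real (p i) - (real (k_even i) + real (k_odd i)) - \<bar>real (k_odd i) - real (k_even i)\<bar>) / 2"
      by (auto simp: max_def min_def)
  qed
  show ?thesis
    unfolding \<open>unknotting_index L = q\<close> q_def map_prod_simp of_nat_sum
    by (intro arg_cong2[of _ _ _ _ Pair] sum.cong refl real_eq)
qed

end
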